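(* (Convergence of tabular Maxmin Q-learning.) Consider a finite Markov decision process and the tabular Maxmin Q-learning iteration with $N\ge1$ estimators, as specified in the context. Assume there is a deterministic constant $C$ such that for every $(s,a)\in\mathcal{S}\times\mathcal{A}$ and $i\in\{1,\dots,N\}$, $0\le\alpha^i_{sa}(t)\le1$ for all $t$ and, with probability $1$, $\sum_{t=0}^\infty(\alpha^i_{sa}(t))^2\le C$ and $\sum_{t=0}^\infty\alpha^i_{sa}(t)=\infty$. Then, with probability $1$, $Q^i_{sa}(t)\to Q^*_{sa}$ as $t\to\infty$ for all $i$ and all $(s,a)$, where $Q^*$ is the optimal action-value function, in either of the following cases: (i) $\gamma<1$; (ii) $\gamma=1$, there is an absorbing reward-free state $s_1$, $Q^i_{s_1a}(0)=0$ for all $a\in\mathcal{A}$ and all $i$, and all stationary policies are proper.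
   Context: **MDP.** $\mathcal{S}$ and $\mathcal{A}$ are finite sets. For $s\in\mathcal{S}$, $a\in\mathcal{A}$, $p_{ss'}(a)\ge0$ with $\sum_{s'}p_{ss'}(a)=1$ are the transition probabilities, and $r_{sa}$ is a random reward with finite variance. $\gamma\in[0,1]$ is the discount factor. A stationary policy is a map $\pi:\mathcal{S}\to\mathcal{A}$; it induces a Markov chain with transition probabilities $p_{ss'}(\pi(s))$. The value $V^\pi_s$ is the limit as $T\to\infty$ of the expected sum $E[\sum_{t=0}^T\gamma^t r_{s_t,\pi(s_t)}\mid s_0=s]$ along this chain $(s_t)$, $V^*_s=\sup_\pi V^\pi_s$, and the optimal action-value function is $Q^*_{sa}=E[r_{sa}]+\gamma\sum_{s'}p_{ss'}(a)V^*_{s'}$. A state $s_1$ is absorbing and reward-free if $p_{s_1s_1}(a)=1$ and $r_{s_1a}=0$ for all $a$. A stationary policy is proper if, from every initial state, the probability of being at $s_1$ at time $t$ tends to $1$ as $t\to\infty$. **Tabular Maxmin Q-learning.** There are $N$ action-value estimates $Q^1(t),\dots,Q^N(t)\in\mathbb{R}^{\mathcal{S}\times\mathcal{A}}$ with given initial values $Q^i(0)$. For $t\ge0$ and every $(s,a)$ and $i$, $$Q^i_{sa}(t+1)=Q^i_{sa}(t)+\alpha^i_{sa}(t)\Big[r_{sa}(t)+\gamma\max_{a'\in\mathcal{A}}\min_{1\le k\le N}Q^{k}_{f(s,a)\,a'}(t)-Q^i_{sa}(t)\Big],$$ where $r_{sa}(t)$ is a random sample of $r_{sa}$ and $f(s,a)$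 is a random successor state sampled at time $t$, equal to $s'$ with probability $p_{ss'}(a)$. The step-size $\alpha^i_{sa}(t)$ is zero when $Q^i_{sa}$ is not updated at iteration $t$. All samples are drawn independently; $\alpha^i_{sa}(t)$ may be random but is measurable with respect to the history $\mathcal{F}(t)$ of the algorithm up to the selection of the step-sizes of iteration $t$ (before the samples of iteration $t$ are drawn). $\mathcal{F}(t)$ is increasing, the initial values are $\mathcal{F}(0)$-measurable, and the samples of iteration $t$ are $\mathcal{F}(t+1)$-measurable and, conditionally on $\mathcal{F}(t)$, have the stated laws. *)

theory Defs
  imports "HOL-Probability.Probability"
begin

text \<open>
  The state space and the action space are finite types. The transition law \<open>p s a\<close> is a
  probability mass function on the states, and \<open>R s a\<close> is the law of the random reward.
\<close>

definition reward_law :: "real measure \<Rightarrow> bool" where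
  "reward_law D \<longleftrightarrow> prob_space D \<and> sets D = sets borel \<and>
     integrable D (\<lambda>x. x) \<and> integrable D (\<lambda>x. x\<^sup>2)"

text \<open>
  Law of the path \<open>[s\<^sub>0, \<dots>, s\<^sub>T]\<close> of the Markov chain induced by a stationary
  policy, started in \<open>s\<close>; the list has length \<open>T + 1\<close>.
\<close>

primrec chain_path ::
  "('s \<Rightarrow> 'a \<Rightarrow> 's pmf) \<Rightarrow> ('s \<Rightarrow> 'a) \<Rightarrow> 's \<Rightarrow> nat \<Rightarrow> 's list pmf" where
  "chain_path p \<pi> s 0 = return_pmf [s]"
| "chain_path p \<pi> s (Suc T) =
     bind_pmf (chain_path p \<pi> s T)
       (\<lambda>xs. map_pmf (\<lambda>s'. xs @ [s']) (p (last xs) (\<pi> (last xs))))"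

text \<open>
  Given the path, the reward collected at time \<open>t\<close> has law
  \<open>R s\<^sub>t (\<pi> s\<^sub>t)\<close>, independently over \<open>t\<close>; the inner integral is the
  expectation over these rewards.
\<close>

definition expected_return ::
  "('s \<Rightarrow> 'a \<Rightarrow> 's pmf) \<Rightarrow> ('s \<Rightarrow> 'a \<Rightarrow> real measure) \<Rightarrow> real \<Rightarrow> ('s \<Rightarrow> 'a) \<Rightarrow> 's \<Rightarrow> nat \<Rightarrow> real"
where
  "expected_return p R \<gamma> \<pi> s T =
     measure_pmf.expectation (chain_path p \<pi> s T)
       (\<lambda>xs. \<integral>w. (\<Sum>t\<le>T. \<gamma> ^ t * w t) \<partial>(\<Pi>\<^sub>M t\<in>{..T}. R (xs ! t) (\<pi> (xs ! t))))"

text \<open>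
  \<open>lim\<close> is unspecified for divergent sequences. The limit exists if \<open>\<bar>\<gamma>\<bar> < 1\<close>, and also
  if \<open>\<gamma> = 1\<close> and the policy is proper for an absorbing reward-free state.
\<close>

definition policy_value ::
  "('s \<Rightarrow> 'a \<Rightarrow> 's pmf) \<Rightarrow> ('s \<Rightarrow> 'a \<Rightarrow> real measure) \<Rightarrow> real \<Rightarrow> ('s \<Rightarrow> 'a) \<Rightarrow> 's \<Rightarrow> real"
where
  "policy_value p R \<gamma> \<pi> s = lim (\<lambda>T. expected_return p R \<gamma> \<pi> s T)"

definition optimal_value ::
  "('s \<Rightarrow> 'a \<Rightarrow> 's pmf) \<Rightarrow> ('s \<Rightarrow> 'a \<Rightarrow> real measure) \<Rightarrow> real \<Rightarrow> 's \<Rightarrow> real"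
where
  "optimal_value p R \<gamma> s = (SUP \<pi>. policy_value p R \<gamma> \<pi> s)"

definition optimal_Q ::
  "('s::finite \<Rightarrow> 'a \<Rightarrow> 's pmf) \<Rightarrow> ('s \<Rightarrow> 'a \<Rightarrow> real measure) \<Rightarrow> real \<Rightarrow> 's \<Rightarrow> 'a \<Rightarrow> real"
where
  "optimal_Q p R \<gamma> s a =
     (\<integral>x. x \<partial>(R s a)) + \<gamma> * (\<Sum>s'\<in>UNIV. pmf (p s a) s' * optimal_value p R \<gamma> s')"

definition absorbing_reward_free ::
  "('s \<Rightarrow> 'a \<Rightarrow> 's pmf) \<Rightarrow> ('s \<Rightarrow> 'a \<Rightarrow> real measure) \<Rightarrow> 's \<Rightarrow> bool"
where
  "absorbing_reward_free p R s\<^sub>1 \<longleftrightarrow>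
     (\<forall>a. pmf (p s\<^sub>1 a) s\<^sub>1 = 1 \<and> (AE x in R s\<^sub>1 a. x = 0))"

definition proper_policy ::
  "('s \<Rightarrow> 'a \<Rightarrow> 's pmf) \<Rightarrow> 's \<Rightarrow> ('s \<Rightarrow> 'a) \<Rightarrow> bool"
where
  "proper_policy p s\<^sub>1 \<pi> \<longleftrightarrow>
     (\<forall>s. (\<lambda>t. measure_pmf.prob (chain_path p \<pi> s t) {xs. xs ! t = s\<^sub>1}) \<longlonglongrightarrow> 1)"

text \<open>
  Conditionally on the sigma-algebra \<open>G\<close>, the rewards \<open>\<rho> s a\<close> and the successor
  states \<open>\<phi> s a\<close>, over all state-action pairs, are jointly independent with laws
  \<open>R s a\<close> and \<open>p s a\<close>. These laws being deterministic, this is tested on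
  \<open>E \<inter> (measurable rectangle)\<close> for \<open>E\<close> in \<open>G\<close>. If \<open>G\<close> also
  contains the history of the earlier samples, the samples are thereby independent over time.
\<close>

definition fresh_samples ::
  "'w measure \<Rightarrow> 'w measure \<Rightarrow> ('s::finite \<Rightarrow> 'a::finite \<Rightarrow> 's pmf) \<Rightarrow> ('s \<Rightarrow> 'a \<Rightarrow> real measure) \<Rightarrow>
   ('s \<Rightarrow> 'a \<Rightarrow> 'w \<Rightarrow> real) \<Rightarrow> ('s \<Rightarrow> 'a \<Rightarrow> 'w \<Rightarrow> 's) \<Rightarrow> bool"
where
  "fresh_samples M G p R \<rho> \<phi> \<longleftrightarrow>
     (\<forall>E\<in>sets G. \<forall>B X. (\<forall>s a. B s a \<in> sets borel) \<longrightarrow>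
        measure M (E \<inter> {\<omega>\<in>space M. \<forall>s a. \<rho> s a \<omega> \<in> B s a \<and> \<phi> s a \<omega> \<in> X s a}) =
        measure M E *
          (\<Prod>s\<in>UNIV. \<Prod>a\<in>UNIV. measure (R s a) (B s a) * measure_pmf.prob (p s a) (X s a)))"

end

theory Submission
  imports Defs
begin

text \<open>
  Let \<open>y\<close> be the vector of all \<open>Q\<^sup>i - Q\<^sup>*\<close>. Its drift contracts a weighted supremum norm with
  factor \<open>\<beta> < 1\<close>: maximum of minima is nonexpansive, and the weights are constant for \<open>\<gamma> < 1\<close> and
  come from the properness of all policies for \<open>\<gamma> = 1\<close>. The noise is linear in the current
  estimates, hence, divided by \<open>G t = 1 + max\<^bsub>\<tau>\<le>t\<^esub> \<parallel>y(\<tau>)\<parallel>\<close>, it has bounded variance, and the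
  step-size weighted series of the normalized noise converges almost surely as a square-integrable
  martingale. From there on the argument is pathwise. Abel summation against the nondecreasing
  factor \<open>G\<close> gives \<open>\<parallel>y(\<tau>)\<parallel> \<le> max A (\<beta> G(t)) + 2\<epsilon> G(t)\<close> for \<open>\<tau> \<le> t\<close>, so \<open>G\<close> is bounded; then
  the noise contributes nothing in the limit and \<open>limsup \<parallel>y\<parallel> \<le> \<beta> limsup \<parallel>y\<parallel>\<close>.
\<close>

subsection \<open>Asynchronous contractions with summable noise\<close>

text \<open>No bound on the iterates is available in advance, and the noise variance grows with
  them. Dividing by \<open>G t\<close>, which is known before the samples of time \<open>t\<close>
  are drawn, makes the variance bounded. Multiplying back costs only a small fraction of
  \<open>G\<close>, because the tails of the normalized series are eventually small, and the gap
  \<open>1 - \<beta>\<close> leaves room for that fraction. The bound \<open>C\<close> on the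
  squared steps is deterministic, so it passes to expectations and no stopping times are needed to
  stay in the square-integrable setting. For \<open>\<gamma> = 1\<close> no weighted norm can
  contract the full transition matrix: the row of \<open>s\<^sub>1\<close> would demand
  \<open>w s\<^sub>1 \<le> \<beta> * w s\<^sub>1\<close>. Transitions into \<open>s\<^sub>1\<close>
  are therefore deleted. This does not alter the drift, since estimates that vanish initially at
  \<open>s\<^sub>1\<close> almost surely stay zero there, as do the optimal values. Properness is
  given for each stationary policy separately, while one weight must serve all actions at once;
  hence the detour through worst-case avoidance probabilities.\<close>

lemma damped_limsup:
  fixes a \<alpha> R :: "nat \<Rightarrow> real" and b \<epsilon> :: real
  assumes step: "\<And>t. t \<ge> t0 \<Longrightarrow> a (Suc t) \<le> (1 - \<alpha> t) * a t + \<alpha> t * b + (R t - R (Suc t))"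
    and \<alpha>: "\<And>t. 0 \<le> \<alpha> t" "\<And>t. \<alpha> t \<le> 1"
    and div: "filterlim (\<lambda>n. \<Sum>t<n. \<alpha> t) at_top sequentially"
    and R: "R \<longlonglongrightarrow> 0" and "\<epsilon> > 0"
  shows "eventually (\<lambda>t. a t \<le> b + \<epsilon>) sequentially"
proof -
  define \<delta> where "\<delta> = \<epsilon> / 3"
  have \<delta>: "\<delta> > 0" using \<open>\<epsilon> > 0\<close> by (simp add: \<delta>_def)
  obtain t1 where t1: "\<And>t. t \<ge> t1 \<Longrightarrow> \<bar>R t\<bar> < \<delta>"
    using R \<delta> unfolding LIMSEQ_iff by auto
  define s where "s = max t0 t1"
  \<comment> \<open>Adding \<open>R t\<close> absorbs the telescoping perturbation. The leftover
    input \<open>\<alpha> t * R t\<close> is at most \<open>\<alpha> t * \<delta>\<close>, which the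
    shift by \<open>\<delta>\<close> cancels.\<close>
  define z where "z t = a t + R t - b - \<delta>" for t
  \<comment> \<open>The positive part is taken so that replacing \<open>1 - \<alpha> t\<close> by
    the larger \<open>exp (- \<alpha> t)\<close> preserves the upper bound.\<close>
  define z0 where "z0 = max (z s) 0"
  have zstep: "z (Suc t) \<le> (1 - \<alpha> t) * z t" if "t \<ge> s" for t
  proof -
    have "\<alpha> t * R t \<le> \<alpha> t * \<delta>"
      using t1[of t] that \<alpha>[of t] by (intro mult_left_mono) (auto simp: s_def)
    then show ?thesis
      using step[of t] that by (simp add: z_def s_def algebra_simps)
  qed
  have bound: "z (s + k) \<le> exp (- (\<Sum>t\<in>{s..<s+k}. \<alpha> t)) * z0" for k
  proof (induction k)
    case (Suc k)
    have "z (s + Suc k) \<le> (1 - \<alpha> (s+k)) * z (s + k)"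
      using zstep[of "s+k"] by simp
    also have "\<dots> \<le> (1 - \<alpha> (s+k)) * (exp (- (\<Sum>t\<in>{s..<s+k}. \<alpha> t)) * z0)"
      using \<alpha>[of "s+k"] Suc by (intro mult_left_mono) auto
    also have "\<dots> \<le> exp (- \<alpha> (s+k)) * (exp (- (\<Sum>t\<in>{s..<s+k}. \<alpha> t)) * z0)"
      using exp_ge_add_one_self[of "- \<alpha> (s+k)"]
      by (intro mult_right_mono) (auto simp: z0_def)
    also have "\<dots> = exp (- (\<Sum>t\<in>{s..<s+Suc k}. \<alpha> t)) * z0"
      by (simp add: exp_add[symmetric] mult.assoc[symmetric])
    finally show ?case .
  qed (simp add: z0_def)
  have "filterlim (\<lambda>n. \<Sum>t\<in>{s..<n}. \<alpha> t) at_top sequentially"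
  proof (rule filterlim_at_top_mono)
    show "filterlim (\<lambda>n. - (\<Sum>t<s. \<alpha> t) + (\<Sum>t<n. \<alpha> t)) at_top sequentially"
      by (rule filterlim_tendsto_add_at_top[OF tendsto_const div])
    show "\<forall>\<^sub>F n in sequentially. - (\<Sum>t<s. \<alpha> t) + (\<Sum>t<n. \<alpha> t) \<le> (\<Sum>t\<in>{s..<n}. \<alpha> t)"
    proof (rule eventually_sequentiallyI[of s])
      fix n assume "s \<le> n"
      then have "(\<Sum>t<n. \<alpha> t) = (\<Sum>t<s. \<alpha> t) + (\<Sum>t\<in>{s..<n}. \<alpha> t)"
        by (metis atLeast0LessThan le0 sum.atLeastLessThan_concat)
      then show "- (\<Sum>t<s. \<alpha> t) + (\<Sum>t<n. \<alpha> t) \<le> (\<Sum>t\<in>{s..<n}. \<alpha> t)" by simp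
    qed
  qed
  then have "(\<lambda>n. exp (- (\<Sum>t\<in>{s..<n}. \<alpha> t)) * z0) \<longlonglongrightarrow> 0 * z0"
    by (intro tendsto_mult tendsto_const filterlim_compose[OF exp_at_bot])
       (auto simp: filterlim_uminus_at_top[symmetric])
  then have "eventually (\<lambda>n. exp (- (\<Sum>t\<in>{s..<n}. \<alpha> t)) * z0 < \<delta>) sequentially"
    using \<delta> by (intro order_tendstoD) auto
  with eventually_ge_at_top[of s] show ?thesis
  proof eventually_elim
    case (elim n)
    then have "z n < \<delta>"
      using bound[of "n - s"] by simp
    then show ?case
      using t1[of n] elim by (auto simp: z_def s_def \<delta>_def)
  qed
qed

text \<open>Abel summation for one step: the noise increment becomes a shift of the target by
  \<open>G * R\<close> and an error carrying only the increment \<open>G' - G\<close>.\<close>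

lemma summation_by_parts_step:
  fixes y \<alpha> h G g :: real
  assumes "y' = (1 - \<alpha>) * y + \<alpha> * h + G * (R - R')"
  shows "y' + G' * R' = (1 - \<alpha>) * (y + G * R) + \<alpha> * (h + G * R) + (G' - G) * R'"
  using assms by (simp add: algebra_simps)

text \<open>
  The noise \<open>G t * n j t\<close> is controlled by Abel summation: with \<open>R j t\<close> the tail of the
  convergent series \<open>\<Sum>t. \<alpha> j t * n j t\<close>, the sequence \<open>y j t + G t * R j t\<close> satisfies a
  recursion whose perturbation is driven by \<open>R j\<close>.
\<close>

locale async_contraction =
  fixes J :: "'j set" and y \<alpha> h n :: "'j \<Rightarrow> nat \<Rightarrow> real" and w :: "'j \<Rightarrow> real" and \<beta> :: real
    and G :: "nat \<Rightarrow> real"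
  assumes finite_J: "finite J"
    and \<alpha>_range: "\<And>j t. j \<in> J \<Longrightarrow> 0 \<le> \<alpha> j t \<and> \<alpha> j t \<le> 1"
    and \<alpha>_div: "\<And>j. j \<in> J \<Longrightarrow> filterlim (\<lambda>n. \<Sum>t<n. \<alpha> j t) at_top sequentially"
    and w_pos: "\<And>j. j \<in> J \<Longrightarrow> w j > 0"
    and \<beta>: "0 \<le> \<beta>" "\<beta> < 1"
    and step: "\<And>j t. j \<in> J \<Longrightarrow> y j (Suc t) = (1 - \<alpha> j t) * y j t + \<alpha> j t * (h j t + G t * n j t)"
    and contr: "\<And>j t m. j \<in> J \<Longrightarrow> (\<And>k. k \<in> J \<Longrightarrow> \<bar>y k t\<bar> \<le> m * w k) \<Longrightarrow> \<bar>h j t\<bar> \<le> \<beta> * m * w j"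
    and noise: "\<And>j. j \<in> J \<Longrightarrow> summable (\<lambda>t. \<alpha> j t * n j t)"
    and G_mono: "mono G" and G_nonneg: "\<And>t. 0 \<le> G t"
    and G_bound: "\<And>j t. j \<in> J \<Longrightarrow> \<bar>y j t\<bar> \<le> G t * w j"
    and G_attained: "\<And>t. \<exists>\<tau>\<le>t. \<exists>j\<in>J. G t \<le> 1 + \<bar>y j \<tau>\<bar> / w j"
begin

definition tail :: "'j \<Rightarrow> nat \<Rightarrow> real" where
  "tail j t = (\<Sum>k. \<alpha> j (k + t) * n j (k + t))"

lemma tail_step: "j \<in> J \<Longrightarrow> tail j t - tail j (Suc t) = \<alpha> j t * n j t"
  using suminf_split_head[of "\<lambda>k. \<alpha> j (k + t) * n j (k + t)"] noise[of j]
  by (simp add: tail_def summable_iff_shift[of "\<lambda>k. \<alpha> j k * n j k" t])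

lemma tail_tendsto: "j \<in> J \<Longrightarrow> tail j \<longlonglongrightarrow> 0"
  unfolding tail_def by (rule suminf_exist_split2[OF noise])

lemma eventually_tail:
  assumes "\<epsilon> > 0"
  shows "eventually (\<lambda>t. \<forall>j\<in>J. \<bar>tail j t\<bar> \<le> \<epsilon> * w j) sequentially"
proof (intro eventually_ball_finite[OF finite_J] ballI)
  fix j assume "j \<in> J"
  then have "eventually (\<lambda>t. \<bar>tail j t\<bar> < \<epsilon> * w j) sequentially"
    using tendsto_rabs_zero[OF tail_tendsto] w_pos assms by (intro order_tendstoD) auto
  then show "eventually (\<lambda>t. \<bar>tail j t\<bar> \<le> \<epsilon> * w j) sequentially"
    by eventually_elim simp
qed

definition z :: "'j \<Rightarrow> nat \<Rightarrow> real" where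
  "z j t = y j t + G t * tail j t"

lemma z_step: "j \<in> J \<Longrightarrow> z j (Suc t) = (1 - \<alpha> j t) * z j t + \<alpha> j t * (h j t + G t * tail j t)
    + (G (Suc t) - G t) * tail j (Suc t)"
  unfolding z_def using step[of j t] tail_step[of j t]
  by (intro summation_by_parts_step) (simp add: algebra_simps)

text \<open>The bound \<open>m\<close> is left free for two uses: \<open>m = G t\<close> to bound
  \<open>G\<close>, and an eventual bound to improve it. The last summand telescopes in
  \<open>t\<close>.\<close>

lemma z_abs_step:
  assumes j: "j \<in> J" and m: "\<And>k. k \<in> J \<Longrightarrow> \<bar>y k t\<bar> \<le> m * w k"
    and tail: "\<bar>tail j t\<bar> \<le> \<epsilon> * w j" "\<bar>tail j (Suc t)\<bar> \<le> \<epsilon> * w j"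
  shows "\<bar>z j (Suc t)\<bar> \<le> (1 - \<alpha> j t) * \<bar>z j t\<bar> + \<alpha> j t * ((\<beta> * m + \<epsilon> * G t) * w j)
    + \<epsilon> * (G (Suc t) - G t) * w j"
proof -
  have \<alpha>: "0 \<le> \<alpha> j t" "\<alpha> j t \<le> 1" using \<alpha>_range[OF j] by auto
  have dG: "0 \<le> G (Suc t) - G t" using G_mono by (simp add: mono_def)
  have 1: "\<bar>h j t + G t * tail j t\<bar> \<le> (\<beta> * m + \<epsilon> * G t) * w j"
  proof -
    have "\<bar>G t * tail j t\<bar> \<le> G t * (\<epsilon> * w j)"
      using tail G_nonneg[of t] by (simp add: abs_mult mult_left_mono)
    then show ?thesis using contr[OF j m] by (simp add: algebra_simps)
  qed
  have "\<bar>z j (Suc t)\<bar> \<le> \<bar>(1 - \<alpha> j t) * z j t\<bar> + \<bar>\<alpha> j t * (h j t + G t * tail j t)\<bar>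
    + \<bar>(G (Suc t) - G t) * tail j (Suc t)\<bar>"
    unfolding z_step[OF j] by linarith
  also have "\<dots> \<le> (1 - \<alpha> j t) * \<bar>z j t\<bar> + \<alpha> j t * ((\<beta> * m + \<epsilon> * G t) * w j)
    + (G (Suc t) - G t) * (\<epsilon> * w j)"
    unfolding abs_mult using \<alpha> dG 1 tail
    by (intro add_mono mult_mono) (auto simp: )
  finally show ?thesis by (simp add: algebra_simps)
qed

lemma G_bounded: "\<exists>B. \<forall>t. G t \<le> B"
proof -
  \<comment> \<open>With this choice
    \<open>1 - \<beta> - 2 * \<epsilon> = (1 - \<beta>) / 2\<close>, the positive coefficient of
    \<open>G t\<close> in the final inequality.\<close>
  define \<epsilon> where "\<epsilon> = (1 - \<beta>) / 4"
  have \<epsilon>: "\<epsilon> > 0" using \<beta> by (simp add: \<epsilon>_def)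
  obtain t0 where t0: "\<And>t j. t \<ge> t0 \<Longrightarrow> j \<in> J \<Longrightarrow> \<bar>tail j t\<bar> \<le> \<epsilon> * w j"
    using eventually_tail[OF \<epsilon>] unfolding eventually_sequentially by blast
  \<comment> \<open>Subtracting \<open>\<epsilon> * G t\<close> absorbs both the increments of
    \<open>G\<close> and the \<open>\<epsilon>\<close> part of the target, so \<open>u\<close>
    relaxes towards \<open>\<beta> * G t\<close> alone.\<close>
  define u where "u j t = \<bar>z j t\<bar> / w j - \<epsilon> * G t" for j t
  \<comment> \<open>The sum dominates every \<open>u j t0\<close>; the summand \<open>G t0\<close>
    covers the times before \<open>t0\<close>.\<close>
  define A where "A = (\<Sum>j\<in>J. \<bar>u j t0\<bar>) + G t0"
  have A0: "A \<ge> 0" "G t0 \<le> A" unfolding A_def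
    using G_nonneg[of t0] by (auto intro!: add_nonneg_nonneg sum_nonneg)
  have u_step: "u j (Suc t) \<le> (1 - \<alpha> j t) * u j t + \<alpha> j t * (\<beta> * G t)" if j: "j \<in> J" and "t \<ge> t0" for j t
  proof -
    have "\<bar>z j (Suc t)\<bar> / w j \<le> ((1 - \<alpha> j t) * \<bar>z j t\<bar> + \<alpha> j t * ((\<beta> * G t + \<epsilon> * G t) * w j)
      + \<epsilon> * (G (Suc t) - G t) * w j) / w j"
      using w_pos[OF j] t0 that
      by (intro divide_right_mono z_abs_step G_bound) auto
    also have "\<dots> = (1 - \<alpha> j t) * (\<bar>z j t\<bar> / w j) + \<alpha> j t * (\<beta> * G t + \<epsilon> * G t)
      + \<epsilon> * (G (Suc t) - G t)"
      using w_pos[OF j] by (simp add: field_simps)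
    finally show ?thesis by (simp add: u_def algebra_simps)
  qed
  have u_bound: "u j t \<le> max A (\<beta> * G t)" if j: "j \<in> J" and "t \<ge> t0" for j t
    using that(2)
  proof (induction t rule: dec_induct)
    case base
    have "u j t0 \<le> (\<Sum>j\<in>J. \<bar>u j t0\<bar>)"
      using member_le_sum[OF j, of "\<lambda>j. \<bar>u j t0\<bar>"] finite_J by simp
    then show ?case using G_nonneg[of t0] by (simp add: A_def)
  next
    case (step t)
    have \<alpha>: "0 \<le> \<alpha> j t" "\<alpha> j t \<le> 1" using \<alpha>_range[OF j] by auto
    have "u j (Suc t) \<le> (1 - \<alpha> j t) * u j t + \<alpha> j t * (\<beta> * G t)"
      using u_step[OF j] step by simp
    also have "\<dots> \<le> (1 - \<alpha> j t) * max A (\<beta> * G t) + \<alpha> j t * max A (\<beta> * G t)"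
      using \<alpha> step by (intro add_mono mult_left_mono) auto
    also have "\<dots> = max A (\<beta> * G t)" by (simp add: algebra_simps)
    also have "\<dots> \<le> max A (\<beta> * G (Suc t))"
      using monoD[OF G_mono, of t "Suc t"] \<beta> by (intro max.mono mult_left_mono) auto
    finally show ?case .
  qed
  \<comment> \<open>One \<open>\<epsilon> * G\<close> returns from \<open>u\<close> to
    \<open>z\<close>, the other from \<open>z\<close> to \<open>y\<close>.\<close>
  have y_bound: "\<bar>y j \<tau>\<bar> / w j \<le> max A (\<beta> * G t) + 2 * \<epsilon> * G t" if j: "j \<in> J" and "\<tau> \<le> t" for j \<tau> t
  proof (cases "\<tau> \<ge> t0")
    case True
    have GG: "G \<tau> \<le> G t" using that G_mono by (simp add: mono_def)
    have "\<bar>y j \<tau>\<bar> \<le> \<bar>z j \<tau>\<bar> + G \<tau> * \<bar>tail j \<tau>\<bar>"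
      using abs_triangle_ineq4[of "z j \<tau>" "G \<tau> * tail j \<tau>"] G_nonneg[of \<tau>]
      by (simp add: z_def abs_mult)
    also have "\<dots> \<le> \<bar>z j \<tau>\<bar> + G \<tau> * (\<epsilon> * w j)"
      using t0[OF True j] G_nonneg[of \<tau>] by (intro add_left_mono mult_left_mono) auto
    finally have "\<bar>y j \<tau>\<bar> / w j \<le> u j \<tau> + 2 * \<epsilon> * G \<tau>"
      using w_pos[OF j] by (simp add: u_def field_simps)
    also have "\<dots> \<le> max A (\<beta> * G \<tau>) + 2 * \<epsilon> * G \<tau>"
      using u_bound[OF j True] by simp
    also have "\<dots> \<le> max A (\<beta> * G t) + 2 * \<epsilon> * G t"
      using GG \<beta> \<epsilon> by (intro add_mono max.mono mult_left_mono) auto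
    finally show ?thesis .
  next
    case False
    then have "G \<tau> \<le> G t0" using G_mono by (simp add: mono_def)
    moreover have "\<bar>y j \<tau>\<bar> / w j \<le> G \<tau>"
      using G_bound[OF j, of \<tau>] w_pos[OF j] by (simp add: field_simps)
    moreover have "0 \<le> 2 * \<epsilon> * G t" using \<epsilon> G_nonneg[of t] by simp
    ultimately show ?thesis using A0 by linarith
  qed
  have "G t \<le> (1 + A) / ((1 - \<beta>) / 2)" for t
  proof -
    obtain \<tau> j where "\<tau> \<le> t" "j \<in> J" "G t \<le> 1 + \<bar>y j \<tau>\<bar> / w j"
      using G_attained by blast
    then have "G t \<le> 1 + (max A (\<beta> * G t) + 2 * \<epsilon> * G t)"
      using y_bound[of j \<tau> t] by linarith
    moreover have "max A (\<beta> * G t) \<le> A + \<beta> * G t"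
      using A0 \<beta> G_nonneg[of t] by simp
    moreover have "2 * \<epsilon> * G t = G t / 2 - \<beta> * G t / 2"
      by (simp add: \<epsilon>_def field_simps)
    ultimately have "G t / 2 - \<beta> * G t / 2 \<le> 1 + A"
      by linarith
    then have "G t * ((1 - \<beta>) / 2) \<le> 1 + A"
      by (simp add: field_simps)
    then show ?thesis using \<beta> by (simp add: pos_le_divide_eq)
  qed
  then show ?thesis by blast
qed

text \<open>Being bounded and monotone, \<open>G\<close> converges to some \<open>g\<close>, so the
  perturbation is the increment of the vanishing sequence
  \<open>\<epsilon> * w j * (g - G t)\<close>, as \<open>damped_limsup\<close> requires.\<close>

lemma eventually_contract:
  assumes m: "eventually (\<lambda>t. \<forall>j\<in>J. \<bar>y j t\<bar> \<le> m * w j) sequentially" and "\<delta> > 0"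
  shows "eventually (\<lambda>t. \<forall>j\<in>J. \<bar>y j t\<bar> \<le> (\<beta> * m + \<delta>) * w j) sequentially"
proof -
  obtain B where B: "\<And>t. G t \<le> B" using G_bounded by blast
  have B0: "B \<ge> 0" using B[of 0] G_nonneg[of 0] by simp
  obtain g where g: "G \<longlonglongrightarrow> g"
    using incseq_convergent[of G B] G_mono B by blast
  \<comment> \<open>The budget \<open>\<delta>\<close> is split in three:
    \<open>\<epsilon> * B\<close> in the target, \<open>\<epsilon> * B\<close> in passing from
    \<open>z\<close> to \<open>y\<close>, and the slack of \<open>damped_limsup\<close>. The
    \<open>+ 1\<close> guards against \<open>B = 0\<close>.\<close>
  define \<epsilon> where "\<epsilon> = \<delta> / (3 * (B + 1))"
  have \<epsilon>: "\<epsilon> > 0" using \<open>\<delta> > 0\<close> B0 by (simp add: \<epsilon>_def)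
  have \<epsilon>B: "\<epsilon> * B \<le> \<delta> / 3"
    using B0 \<open>\<delta> > 0\<close> by (simp add: \<epsilon>_def field_simps)
  obtain t0 where t0: "\<And>t j. t \<ge> t0 \<Longrightarrow> j \<in> J \<Longrightarrow> \<bar>tail j t\<bar> \<le> \<epsilon> * w j"
    "\<And>t j. t \<ge> t0 \<Longrightarrow> j \<in> J \<Longrightarrow> \<bar>y j t\<bar> \<le> m * w j"
    using eventually_conj[OF eventually_tail[OF \<epsilon>] m] unfolding eventually_sequentially by blast
  show ?thesis
  proof (intro eventually_ball_finite[OF finite_J] ballI)
    fix j assume j: "j \<in> J"
    have "eventually (\<lambda>t. \<bar>z j t\<bar> \<le> (\<beta> * m + \<epsilon> * B) * w j + \<delta> / 3 * w j) sequentially"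
    proof (rule damped_limsup)
      fix t assume t: "t \<ge> t0"
      have "\<bar>z j (Suc t)\<bar> \<le> (1 - \<alpha> j t) * \<bar>z j t\<bar> + \<alpha> j t * ((\<beta> * m + \<epsilon> * G t) * w j)
        + \<epsilon> * (G (Suc t) - G t) * w j"
        using t by (intro z_abs_step j t0) auto
      also have "\<dots> \<le> (1 - \<alpha> j t) * \<bar>z j t\<bar> + \<alpha> j t * ((\<beta> * m + \<epsilon> * B) * w j)
        + \<epsilon> * (G (Suc t) - G t) * w j"
        using \<alpha>_range[OF j, of t] w_pos[OF j] \<epsilon> B[of t]
        by (intro add_mono mult_left_mono mult_right_mono order_refl) auto
      finally show "\<bar>z j (Suc t)\<bar> \<le> (1 - \<alpha> j t) * \<bar>z j t\<bar> + \<alpha> j t * ((\<beta> * m + \<epsilon> * B) * w j)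
        + (\<epsilon> * w j * (g - G t) - \<epsilon> * w j * (g - G (Suc t)))"
        by (simp add: algebra_simps)
    next
      have "(\<lambda>t. \<epsilon> * w j * (g - G t)) \<longlonglongrightarrow> \<epsilon> * w j * (g - g)"
        by (intro tendsto_intros g)
      then show "(\<lambda>t. \<epsilon> * w j * (g - G t)) \<longlonglongrightarrow> 0" by simp
    qed (use \<alpha>_range \<alpha>_div j w_pos \<open>\<delta> > 0\<close> in auto)
    with eventually_ge_at_top[of t0]
    show "eventually (\<lambda>t. \<bar>y j t\<bar> \<le> (\<beta> * m + \<delta>) * w j) sequentially"
    proof eventually_elim
      case (elim t)
      have "\<bar>y j t\<bar> \<le> \<bar>z j t\<bar> + G t * \<bar>tail j t\<bar>"
        using abs_triangle_ineq4[of "z j t" "G t * tail j t"] G_nonneg[of t]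
        by (simp add: z_def abs_mult)
      also have "\<dots> \<le> \<bar>z j t\<bar> + B * (\<epsilon> * w j)"
        using t0(1)[of t j] elim j G_nonneg[of t] B[of t] B0 by (intro add_left_mono mult_mono) auto
      also have "\<dots> \<le> (\<beta> * m + 2 * (\<epsilon> * B) + \<delta> / 3) * w j"
        using elim by (simp add: algebra_simps)
      also have "\<dots> \<le> (\<beta> * m + \<delta>) * w j"
        using \<epsilon>B w_pos[OF j] by (intro mult_right_mono) auto
      finally show ?case .
    qed
  qed
qed

text \<open>The infimum \<open>I\<close> of the eventual bounds plays the part of the upper limit of
  the weighted norm. It need not be an eventual bound itself, so \<open>I \<le> \<beta> * I\<close>
  is reached with a slack \<open>\<delta>\<close>.\<close>

theorem y_tendsto_0:
  assumes j: "j \<in> J"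
  shows "y j \<longlonglongrightarrow> 0"
proof -
  define X where "X = {m. 0 \<le> m \<and> eventually (\<lambda>t. \<forall>j\<in>J. \<bar>y j t\<bar> \<le> m * w j) sequentially}"
  obtain B where B: "\<And>t. G t \<le> B" using G_bounded by blast
  have "\<bar>y j t\<bar> \<le> B * w j" if "j \<in> J" for j t
    by (rule order_trans[OF G_bound[OF that, of t]]) (use B w_pos that in \<open>auto intro: mult_right_mono less_imp_le\<close>)
  then have BX: "B \<in> X" using B[of 0] G_nonneg[of 0] by (auto simp: X_def)
  then have X_ne: "X \<noteq> {}" by blast
  have bdd: "bdd_below X" by (auto simp: X_def)
  define I where "I = Inf X"
  have I0: "I \<ge> 0" unfolding I_def using BX by (intro cInf_greatest) (auto simp: X_def)
  have "I \<le> \<beta> * I + \<delta>" if \<delta>: "\<delta> > 0" for \<delta>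
  proof -
    obtain m where m: "m \<in> X" "m < I + \<delta> / 2"
      using cInf_lessD[of X "I + \<delta>/2"] X_ne \<delta> by (auto simp: I_def)
    have "\<beta> * m + \<delta> / 2 \<in> X"
      using eventually_contract[of m "\<delta>/2"] m that \<beta> by (auto simp: X_def)
    then have "I \<le> \<beta> * m + \<delta> / 2" unfolding I_def by (intro cInf_lower bdd)
    also have "\<dots> \<le> \<beta> * (I + \<delta> / 2) + \<delta> / 2"
      using m \<beta> by (intro add_mono mult_left_mono) auto
    also have "\<dots> \<le> \<beta> * I + \<delta>"
    proof -
      have "\<beta> * \<delta> \<le> \<delta>" using \<beta> \<delta> by (intro mult_left_le_one_le) auto
      then show ?thesis by (simp add: algebra_simps)
    qed
    finally show ?thesis .
  qed
  then have "I \<le> \<beta> * I" by (rule field_le_epsilon)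
  then have "(1 - \<beta>) * I \<le> 0" by (simp add: algebra_simps)
  then have I: "I = 0" using \<beta> I0 by (simp add: mult_le_0_iff)
  show ?thesis
  proof (rule tendstoI)
    fix e :: real assume "e > 0"
    then have "e / w j > 0" using w_pos[OF j] by simp
    then obtain m where m: "m \<in> X" "m < e / w j"
      using cInf_lessD[of X "e / w j"] X_ne I by (auto simp: I_def)
    have "m * w j < e" using m w_pos[OF j] by (simp add: field_simps)
    moreover have "eventually (\<lambda>t. \<bar>y j t\<bar> \<le> m * w j) sequentially"
      using m j by (auto simp: X_def elim: eventually_mono)
    ultimately show "eventually (\<lambda>t. dist (y j t) 0 < e) sequentially"
      by (auto elim: eventually_mono)
  qed
qed

end

subsection \<open>Series of predictable multiples of independent noise\<close>

text \<open>Independence from the past with mean zero is stronger than a martingale difference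
  condition; it lets expectations of products factor, so conditional expectations never
  appear.\<close>

locale predictable_noise = prob_space M for M :: "'w measure" +
  fixes F :: "nat \<Rightarrow> 'w measure" and \<xi> :: "nat \<Rightarrow> 'w \<Rightarrow> real" and K :: real
  assumes filtration_F: "filtration (space M) F" and subalgebra_F: "\<And>t. subalgebra M (F t)"
    and \<xi>_meas: "\<And>t. \<xi> t \<in> borel_measurable (F (Suc t))"
    and \<xi>_indep: "\<And>t E B. E \<in> sets (F t) \<Longrightarrow> B \<in> sets borel \<Longrightarrow>
      prob (E \<inter> {\<omega>\<in>space M. \<xi> t \<omega> \<in> B}) = prob E * prob {\<omega>\<in>space M. \<xi> t \<omega> \<in> B}"
    and \<xi>_square: "\<And>t. integrable M (\<lambda>\<omega>. (\<xi> t \<omega>)\<^sup>2)"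
    and \<xi>_mean: "\<And>t. expectation (\<xi> t) = 0"
    and \<xi>_variance: "\<And>t. expectation (\<lambda>\<omega>. (\<xi> t \<omega>)\<^sup>2) \<le> K"
begin

lemma measurable_F_mono: "s \<le> t \<Longrightarrow> X \<in> measurable (F s) N \<Longrightarrow> X \<in> measurable (F t) N"
  using filtration.sets_F_mono[OF filtration_F, of s t] filtration.space_F[OF filtration_F]
  by (auto simp: measurable_def)

lemma measurable_F_M: "X \<in> measurable (F s) N \<Longrightarrow> X \<in> measurable M N"
  using measurable_from_subalg[OF subalgebra_F] .

lemma \<xi>_meas_M [measurable]: "\<xi> t \<in> borel_measurable M"
  by (rule measurable_F_M[OF \<xi>_meas])

lemma \<xi>_integrable: "integrable M (\<xi> t)"
  by (rule square_integrable_imp_integrable[OF \<xi>_meas_M \<xi>_square])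

lemma K_nonneg: "0 \<le> K"
  by (rule order_trans[OF _ \<xi>_variance[of 0]]) simp

text \<open>Preimages under \<open>X\<close> lie in \<open>F t\<close>, so
  \<open>\<xi>_indep\<close> is the product rule on generators; both generating families are closed
  under intersection.\<close>

lemma indep_var_past:
  assumes X: "X \<in> borel_measurable (F t)"
  shows "indep_var borel X borel (\<xi> t)"
  unfolding indep_var_eq
proof (intro conjI indep_set_sigma_sets indep_setI)
  show X_M: "X \<in> borel_measurable M" by (rule measurable_F_M[OF X])
  show "{X -` A \<inter> space M |A. A \<in> sets borel} \<subseteq> events"
    using X_M by (auto intro: measurable_sets)
  show "{\<xi> t -` A \<inter> space M |A. A \<in> sets borel} \<subseteq> events"
    by (auto intro: measurable_sets[OF \<xi>_meas_M])
  show "Int_stable {X -` A \<inter> space M |A. A \<in> sets borel}"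
    by (auto simp: Int_stable_def) (metis (no_types) sets.Int vimage_Int Int_assoc Int_commute Int_left_absorb)
  show "Int_stable {\<xi> t -` A \<inter> space M |A. A \<in> sets borel}"
    by (auto simp: Int_stable_def) (metis (no_types) sets.Int vimage_Int Int_assoc Int_commute Int_left_absorb)
  fix a b assume "a \<in> {X -` A \<inter> space M |A. A \<in> sets borel}"
    and "b \<in> {\<xi> t -` A \<inter> space M |A. A \<in> sets borel}"
  then obtain A B where AB: "A \<in> sets borel" "B \<in> sets borel"
    "a = X -` A \<inter> space M" "b = \<xi> t -` B \<inter> space M" by blast
  have "a \<in> sets (F t)"
    using measurable_sets[OF X AB(1)] AB(3) filtration.space_F[OF filtration_F] by simp
  moreover have "b = {\<omega>\<in>space M. \<xi> t \<omega> \<in> B}" using AB by auto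
  ultimately show "prob (a \<inter> b) = prob a * prob b"
    using \<xi>_indep AB(2) by simp
qed simp

lemma past_times_noise:
  assumes "X \<in> borel_measurable (F t)" "integrable M X"
  shows "integrable M (\<lambda>\<omega>. X \<omega> * \<xi> t \<omega>)" "expectation (\<lambda>\<omega>. X \<omega> * \<xi> t \<omega>) = 0"
  using indep_var_integrable[OF indep_var_past[OF assms(1)] assms(2) \<xi>_integrable]
    indep_var_lebesgue_integral[OF indep_var_past[OF assms(1)] assms(2) \<xi>_integrable] \<xi>_mean
  by auto

lemma past_times_noise_square:
  assumes "X \<in> borel_measurable (F t)" "integrable M X"
  shows "integrable M (\<lambda>\<omega>. X \<omega> * (\<xi> t \<omega>)\<^sup>2)"
    "expectation (\<lambda>\<omega>. X \<omega> * (\<xi> t \<omega>)\<^sup>2) = expectation X * expectation (\<lambda>\<omega>. (\<xi> t \<omega>)\<^sup>2)"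
proof -
  have "indep_var borel ((\<lambda>x. x) \<circ> X) borel ((\<lambda>x. x\<^sup>2) \<circ> \<xi> t)"
    by (rule indep_var_compose[OF indep_var_past[OF assms(1)]]) auto
  then have I: "indep_var borel X borel (\<lambda>\<omega>. (\<xi> t \<omega>)\<^sup>2)" by (simp add: comp_def)
  show "integrable M (\<lambda>\<omega>. X \<omega> * (\<xi> t \<omega>)\<^sup>2)"
    "expectation (\<lambda>\<omega>. X \<omega> * (\<xi> t \<omega>)\<^sup>2) = expectation X * expectation (\<lambda>\<omega>. (\<xi> t \<omega>)\<^sup>2)"
    by (rule indep_var_integrable[OF I assms(2) \<xi>_square]
        indep_var_lebesgue_integral[OF I assms(2) \<xi>_square])+
qed

text \<open>With the half-open range, \<open>msum g m n\<close> involves noise only up to time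
  \<open>n - 1\<close> and so belongs to the past of \<open>\<xi> n\<close>.\<close>

definition msum :: "(nat \<Rightarrow> 'w \<Rightarrow> real) \<Rightarrow> nat \<Rightarrow> nat \<Rightarrow> 'w \<Rightarrow> real" where
  "msum g m n \<omega> = (\<Sum>t\<in>{m..<n}. g t \<omega> * \<xi> t \<omega>)"

lemma msum_meas:
  assumes "\<And>t. g t \<in> borel_measurable (F t)"
  shows "msum g m n \<in> borel_measurable (F n)"
  unfolding msum_def
  by (intro borel_measurable_sum borel_measurable_times measurable_F_mono[OF _ assms]
      measurable_F_mono[OF _ \<xi>_meas]) auto

lemma bounded_predictable_integrable:
  fixes g :: "'w \<Rightarrow> real"
  assumes "g \<in> borel_measurable (F t)" "\<And>\<omega>. \<omega> \<in> space M \<Longrightarrow> \<bar>g \<omega>\<bar> \<le> 1"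
  shows "integrable M (\<lambda>\<omega>. (g \<omega>)\<^sup>2)"
proof (rule integrable_const_bound[where B = 1])
  show "AE \<omega> in M. norm ((g \<omega>)\<^sup>2) \<le> 1"
    using assms(2) by (auto simp: abs_square_le_1)
  show "(\<lambda>\<omega>. (g \<omega>)\<^sup>2) \<in> borel_measurable M"
    using measurable_F_M[OF assms(1)] by measurable
qed

text \<open>Orthogonality of increments: the cross term pairs a quantity known at time
  \<open>n\<close> with the centred \<open>\<xi> n\<close> and vanishes, while the new square
  factors by independence and costs at most \<open>K\<close>.\<close>

lemma msum_second_moment:
  assumes g_meas: "\<And>t. g t \<in> borel_measurable (F t)"
    and g_bound: "\<And>t \<omega>. \<omega> \<in> space M \<Longrightarrow> \<bar>g t \<omega>\<bar> \<le> 1"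
    and "m \<le> n"
  shows "integrable M (\<lambda>\<omega>. (msum g m n \<omega>)\<^sup>2) \<and>
    expectation (\<lambda>\<omega>. (msum g m n \<omega>)\<^sup>2) \<le> K * (\<Sum>t\<in>{m..<n}. expectation (\<lambda>\<omega>. (g t \<omega>)\<^sup>2))"
  using \<open>m \<le> n\<close>
proof (induction n rule: dec_induct)
  case base
  then show ?case by (simp add: msum_def)
next
  case (step n)
  let ?S = "msum g m n"
  have S_M: "?S \<in> borel_measurable M" by (rule measurable_F_M[OF msum_meas[OF g_meas]])
  have g_M: "g n \<in> borel_measurable M" by (rule measurable_F_M[OF g_meas])
  have eq: "(msum g m (Suc n) \<omega>)\<^sup>2 =
      (?S \<omega>)\<^sup>2 + 2 * ((?S \<omega> * g n \<omega>) * \<xi> n \<omega>) + (g n \<omega>)\<^sup>2 * (\<xi> n \<omega>)\<^sup>2" for \<omega>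
    using step(1) by (simp add: msum_def power2_eq_square algebra_simps)
  have "integrable M ?S"
    by (rule square_integrable_imp_integrable[OF S_M]) (use step in auto)
  then have "integrable M (\<lambda>\<omega>. ?S \<omega> * g n \<omega>)"
  proof (rule Bochner_Integration.integrable_bound)
    show "(\<lambda>\<omega>. ?S \<omega> * g n \<omega>) \<in> borel_measurable M" using S_M g_M by measurable
    show "AE \<omega> in M. norm (?S \<omega> * g n \<omega>) \<le> norm (?S \<omega>)"
      using g_bound by (auto simp: abs_mult intro!: mult_left_le)
  qed
  then have 1: "integrable M (\<lambda>\<omega>. (?S \<omega> * g n \<omega>) * \<xi> n \<omega>)"
    "expectation (\<lambda>\<omega>. (?S \<omega> * g n \<omega>) * \<xi> n \<omega>) = 0"
    by (intro past_times_noise borel_measurable_times msum_meas g_meas; assumption)+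
  have g2: "integrable M (\<lambda>\<omega>. (g n \<omega>)\<^sup>2)"
    by (rule bounded_predictable_integrable[OF g_meas g_bound])
  have g2_meas: "(\<lambda>\<omega>. (g n \<omega>)\<^sup>2) \<in> borel_measurable (F n)" using g_meas[of n] by measurable
  note 2 = past_times_noise_square[OF g2_meas g2]
  have "expectation (\<lambda>\<omega>. (g n \<omega>)\<^sup>2 * (\<xi> n \<omega>)\<^sup>2) \<le> K * expectation (\<lambda>\<omega>. (g n \<omega>)\<^sup>2)"
    unfolding 2(2) by (subst mult.commute, intro mult_right_mono \<xi>_variance) simp
  moreover have "expectation (\<lambda>\<omega>. (msum g m (Suc n) \<omega>)\<^sup>2) =
      expectation (\<lambda>\<omega>. (?S \<omega>)\<^sup>2) + expectation (\<lambda>\<omega>. (g n \<omega>)\<^sup>2 * (\<xi> n \<omega>)\<^sup>2)"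
    unfolding eq using step 1 2(1) by simp
  moreover have "integrable M (\<lambda>\<omega>. (msum g m (Suc n) \<omega>)\<^sup>2)"
    unfolding eq using step 1 2(1) by simp
  ultimately show ?case using step by (simp add: algebra_simps)
qed

text \<open>
  Replacing \<open>g\<close> by 0 once the sum has left \<open>[-\<epsilon>, \<epsilon>]\<close> freezes it outside, which reduces the maximal
  inequality to Markov's inequality for the terminal second moment.
\<close>

lemma msum_maximal:
  assumes g_meas: "\<And>t. g t \<in> borel_measurable (F t)"
    and g_bound: "\<And>t \<omega>. \<omega> \<in> space M \<Longrightarrow> \<bar>g t \<omega>\<bar> \<le> 1"
    and "m \<le> n" and "\<epsilon> > 0"
  shows "prob {\<omega>\<in>space M. \<exists>j\<in>{m..n}. \<bar>msum g m j \<omega>\<bar> > \<epsilon>} \<le>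
    K * (\<Sum>t\<in>{m..<n}. expectation (\<lambda>\<omega>. (g t \<omega>)\<^sup>2)) / \<epsilon>\<^sup>2"
proof -
  define ok where "ok t \<omega> \<longleftrightarrow> (\<forall>j\<in>{m..t}. \<bar>msum g m j \<omega>\<bar> \<le> \<epsilon>)" for t \<omega>
  \<comment> \<open>\<open>ok t\<close> inspects sums up to index \<open>t\<close>, hence noise up
    to \<open>t - 1\<close>, so the stopped multiplier is still predictable and the second moment
    bound applies to it.\<close>
  define k where "k t \<omega> = (if ok t \<omega> then g t \<omega> else 0)" for t \<omega>
  have ok_pred: "Measurable.pred (F t) (ok t)" for t
    unfolding ok_def
  proof (intro pred_intros_finite)
    fix j assume "j \<in> {m..t}"
    then have "msum g m j \<in> borel_measurable (F t)"
      using measurable_F_mono[OF _ msum_meas[OF g_meas], of j t] by simp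
    then show "Measurable.pred (F t) (\<lambda>\<omega>. \<bar>msum g m j \<omega>\<bar> \<le> \<epsilon>)" by measurable
  qed simp
  have k_meas: "k t \<in> borel_measurable (F t)" for t
    unfolding k_def using ok_pred[of t] g_meas[of t] by measurable
  have k_bound: "\<bar>k t \<omega>\<bar> \<le> 1" if "\<omega> \<in> space M" for t \<omega>
    using g_bound[OF that] by (simp add: k_def)
  have frozen: "\<bar>msum k m n' \<omega>\<bar> > \<epsilon>" if "j \<in> {m..n'}" "\<bar>msum g m j \<omega>\<bar> > \<epsilon>" for \<omega> j n'
  proof -
    \<comment> \<open>The first exit index: \<open>k\<close> agrees with \<open>g\<close> before
      \<open>i\<close> and is 0 from \<open>i\<close> on, so the stopped sum keeps the value at
      which it left the interval.\<close>
    define i where "i = (LEAST j. m \<le> j \<and> \<bar>msum g m j \<omega>\<bar> > \<epsilon>)"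
    have i: "m \<le> i" "\<bar>msum g m i \<omega>\<bar> > \<epsilon>"
      using LeastI[of "\<lambda>j. m \<le> j \<and> \<bar>msum g m j \<omega>\<bar> > \<epsilon>" j] that by (auto simp: i_def)
    have ij: "i \<le> j" unfolding i_def using that by (intro Least_le) auto
    have before: "ok t \<omega>" if "t < i" for t
      unfolding ok_def
    proof
      fix l assume "l \<in> {m..t}"
      then show "\<bar>msum g m l \<omega>\<bar> \<le> \<epsilon>"
        using not_less_Least[of l "\<lambda>j. m \<le> j \<and> \<bar>msum g m j \<omega>\<bar> > \<epsilon>"] that
        by (auto simp: i_def not_less)
    qed
    have after: "\<not> ok t \<omega>" if "t \<ge> i" for t
      using i that by (auto simp: ok_def not_le intro!: bexI[of _ i])
    have "msum k m n' \<omega> = msum k m i \<omega> + msum k i n' \<omega>"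
      unfolding msum_def using i ij that by (intro sum.atLeastLessThan_concat[symmetric]) auto
    also have "msum k i n' \<omega> = 0"
      unfolding msum_def k_def using after by (intro sum.neutral) auto
    also have "msum k m i \<omega> = msum g m i \<omega>"
      unfolding msum_def k_def using before by (intro sum.cong) auto
    finally show ?thesis using i by simp
  qed
  have S_M: "msum k m n \<in> borel_measurable M" by (rule measurable_F_M[OF msum_meas[OF k_meas]])
  note mom = msum_second_moment[OF k_meas k_bound \<open>m \<le> n\<close>]
  have "prob {\<omega>\<in>space M. \<exists>j\<in>{m..n}. \<bar>msum g m j \<omega>\<bar> > \<epsilon>}
      \<le> prob {\<omega>\<in>space M. \<epsilon>\<^sup>2 \<le> (msum k m n \<omega>)\<^sup>2}"
  proof (rule finite_measure_mono)
    show "{\<omega>\<in>space M. \<exists>j\<in>{m..n}. \<bar>msum g m j \<omega>\<bar> > \<epsilon>} \<subseteq> {\<omega>\<in>space M. \<epsilon>\<^sup>2 \<le> (msum k m n \<omega>)\<^sup>2}"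
      using frozen[of _ n] \<open>\<epsilon> > 0\<close> by (auto simp: abs_le_square_iff[symmetric] intro: less_imp_le)
    show "{\<omega>\<in>space M. \<epsilon>\<^sup>2 \<le> (msum k m n \<omega>)\<^sup>2} \<in> events"
      using S_M by measurable
  qed
  also have "\<dots> \<le> expectation (\<lambda>\<omega>. (msum k m n \<omega>)\<^sup>2) / \<epsilon>\<^sup>2"
    using mom \<open>\<epsilon> > 0\<close> by (intro integral_Markov_inequality_measure[of _ _ "{}"]) auto
  also have "\<dots> \<le> (K * (\<Sum>t\<in>{m..<n}. expectation (\<lambda>\<omega>. (k t \<omega>)\<^sup>2))) / \<epsilon>\<^sup>2"
    using mom \<open>\<epsilon> > 0\<close> by (intro divide_right_mono) auto
  also have "\<dots> \<le> (K * (\<Sum>t\<in>{m..<n}. expectation (\<lambda>\<omega>. (g t \<omega>)\<^sup>2))) / \<epsilon>\<^sup>2"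
    using K_nonneg
    by (intro divide_right_mono mult_left_mono sum_mono integral_mono
        bounded_predictable_integrable[OF k_meas k_bound] bounded_predictable_integrable[OF g_meas g_bound])
      (auto simp: k_def)
  finally show ?thesis .
qed

text \<open>The bound \<open>C\<close> makes the expected squares summable, so the maximal
  inequality bounds the probability of any fluctuation above \<open>\<epsilon>\<close> after time
  \<open>m\<close> by a vanishing tail; this yields the Cauchy property almost surely.\<close>

theorem AE_summable:
  assumes g_meas: "\<And>t. g t \<in> borel_measurable (F t)"
    and g_bound: "\<And>t \<omega>. \<omega> \<in> space M \<Longrightarrow> \<bar>g t \<omega>\<bar> \<le> 1"
    and squares: "AE \<omega> in M. summable (\<lambda>t. (g t \<omega>)\<^sup>2) \<and> (\<Sum>t. (g t \<omega>)\<^sup>2) \<le> C"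
  shows "AE \<omega> in M. summable (\<lambda>t. g t \<omega> * \<xi> t \<omega>)"
proof -
  define e where "e t = expectation (\<lambda>\<omega>. (g t \<omega>)\<^sup>2)" for t
  have g2: "integrable M (\<lambda>\<omega>. (g t \<omega>)\<^sup>2)" for t
    by (rule bounded_predictable_integrable[OF g_meas g_bound])
  have e0: "e t \<ge> 0" for t by (simp add: e_def)
  have "(\<Sum>t<n. e t) \<le> C" for n
  proof -
    have "(\<Sum>t<n. e t) = expectation (\<lambda>\<omega>. \<Sum>t<n. (g t \<omega>)\<^sup>2)"
      using g2 by (simp add: e_def)
    also have "\<dots> \<le> expectation (\<lambda>\<omega>. C)"
    proof (rule integral_mono_AE)
      show "AE \<omega> in M. (\<Sum>t<n. (g t \<omega>)\<^sup>2) \<le> C"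
        using squares by eventually_elim (meson sum_le_suminf finite_lessThan order_trans zero_le_power2)
    qed (use g2 in auto)
    also have "\<dots> = C" by (simp add: prob_space)
    finally show ?thesis .
  qed
  then have e_summable: "summable e"
    by (intro summableI_nonneg_bounded e0)
  define tl where "tl m = (\<Sum>t. e (t + m))" for m
  have tl_lim: "tl \<longlonglongrightarrow> 0"
    unfolding tl_def by (rule suminf_exist_split2[OF e_summable])
  define bad where "bad \<epsilon> m n = {\<omega>\<in>space M. \<exists>j\<in>{m..n}. \<bar>msum g m j \<omega>\<bar> > \<epsilon>}" for \<epsilon> m n
  have S_M: "msum g m n \<in> borel_measurable M" for m n by (rule measurable_F_M[OF msum_meas[OF g_meas]])
  have bad_ev [measurable]: "bad \<epsilon> m n \<in> events" for \<epsilon> m n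
    unfolding bad_def using S_M by measurable
  have bad_prob: "prob (bad \<epsilon> m n) \<le> K * tl m / \<epsilon>\<^sup>2" if "\<epsilon> > 0" for \<epsilon> m n
  proof (cases "m \<le> n")
    case True
    have "prob (bad \<epsilon> m n) \<le> K * (\<Sum>t\<in>{m..<n}. e t) / \<epsilon>\<^sup>2"
      unfolding bad_def e_def by (rule msum_maximal[OF g_meas g_bound True that])
    also have "(\<Sum>t\<in>{m..<n}. e t) = (\<Sum>t<n - m. e (t + m))"
      using True sum.shift_bounds_nat_ivl[of e 0 m "n - m"] by (simp add: atLeast0LessThan)
    also have "K * \<dots> / \<epsilon>\<^sup>2 \<le> K * tl m / \<epsilon>\<^sup>2"
      unfolding tl_def using K_nonneg e0 e_summable
      by (intro divide_right_mono mult_left_mono sum_le_suminf) (auto simp: summable_iff_shift)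
    finally show ?thesis .
  next
    case False
    have "tl m \<ge> 0" unfolding tl_def using e0 e_summable by (intro suminf_nonneg) (auto simp: summable_iff_shift)
    moreover have "bad \<epsilon> m n = {}" using False by (auto simp: bad_def)
    ultimately show ?thesis using K_nonneg by simp
  qed
  have Bad_prob: "prob (\<Union>n. bad \<epsilon> m n) \<le> K * tl m / \<epsilon>\<^sup>2" if "\<epsilon> > 0" for \<epsilon> m
  proof (rule LIMSEQ_le_const2)
    have "incseq (bad \<epsilon> m)"
      unfolding incseq_def bad_def by fastforce
    then show "(\<lambda>n. prob (bad \<epsilon> m n)) \<longlonglongrightarrow> prob (\<Union>n. bad \<epsilon> m n)"
      by (intro finite_Lim_measure_incseq) auto
    show "\<exists>N. \<forall>n\<ge>N. prob (bad \<epsilon> m n) \<le> K * tl m / \<epsilon>\<^sup>2" using bad_prob[OF that] by blast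
  qed
  have good: "AE \<omega> in M. \<exists>m. \<forall>n\<ge>m. \<bar>msum g m n \<omega>\<bar> \<le> \<epsilon>" if "\<epsilon> > 0" for \<epsilon>
  proof (rule AE_I)
    \<comment> \<open>The event that deviations exceed \<open>\<epsilon>\<close> from every starting
      time; it lies inside each single union over \<open>n\<close>, whose probability tends to 0
      with \<open>m\<close>.\<close>
    let ?N = "\<Inter>m. \<Union>n. bad \<epsilon> m n"
    show N: "?N \<in> events" by measurable
    show "{\<omega>\<in>space M. \<not> (\<exists>m. \<forall>n\<ge>m. \<bar>msum g m n \<omega>\<bar> \<le> \<epsilon>)} \<subseteq> ?N"
      unfolding bad_def by (force simp: not_le)
    have "prob ?N \<le> K * tl m / \<epsilon>\<^sup>2" for m
      by (rule order_trans[OF finite_measure_mono Bad_prob[OF that, of m]]) auto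
    moreover have "(\<lambda>m. K * tl m / \<epsilon>\<^sup>2) \<longlonglongrightarrow> K * 0 / \<epsilon>\<^sup>2"
      using that by (intro tendsto_intros tl_lim) auto
    ultimately have "prob ?N \<le> 0"
      by (intro LIMSEQ_le_const[where x = 0 and X = "\<lambda>m. K * tl m / \<epsilon>\<^sup>2"]) auto
    then show "emeasure M ?N = 0"
      by (simp add: emeasure_eq_measure measure_le_0_iff)
  qed
  have "AE \<omega> in M. \<forall>k. \<exists>m. \<forall>n\<ge>m. \<bar>msum g m n \<omega>\<bar> \<le> inverse (real (Suc k))"
    unfolding AE_all_countable by (intro allI good) simp
  then show ?thesis
  proof eventually_elim
    case (elim \<omega>)
    show ?case
      unfolding summable_Cauchy
    proof (intro allI impI)
      fix \<epsilon> :: real assume "\<epsilon> > 0"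
      \<comment> \<open>Half of \<open>\<epsilon>\<close> suffices because a block from
        \<open>m'\<close> to \<open>n\<close> is the difference of two sums starting at
        \<open>m\<close>.\<close>
      then obtain k where k: "inverse (real (Suc k)) < \<epsilon> / 2"
        using reals_Archimedean[of "\<epsilon> / 2"] by auto
      from elim obtain m where m: "\<And>n. n \<ge> m \<Longrightarrow> \<bar>msum g m n \<omega>\<bar> \<le> inverse (real (Suc k))" by blast
      have "\<bar>msum g m' n \<omega>\<bar> < \<epsilon>" if "m' \<ge> m" for m' n
      proof (cases "m' \<le> n")
        case True
        then have "msum g m n \<omega> = msum g m m' \<omega> + msum g m' n \<omega>"
          unfolding msum_def using that by (intro sum.atLeastLessThan_concat[symmetric]) auto
        then show ?thesis using m[of n] m[of m'] that True k by linarith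
      qed (use \<open>\<epsilon> > 0\<close> in \<open>simp add: msum_def\<close>)
      then show "\<exists>N. \<forall>m\<ge>N. \<forall>n. norm (\<Sum>t\<in>{m..<n}. g t \<omega> * \<xi> t \<omega>) < \<epsilon>"
        by (auto simp: msum_def)
    qed
  qed
qed

end

subsection \<open>Policy values and the Bellman equation\<close>

text \<open>The kernel need not be stochastic: the operator serves both the transition matrix and
  its discounted version with absorbing states removed.\<close>

definition kernel_op :: "('s::finite \<Rightarrow> 'a \<Rightarrow> 's \<Rightarrow> real) \<Rightarrow> ('s \<Rightarrow> 'a) \<Rightarrow> ('s \<Rightarrow> real) \<Rightarrow> 's \<Rightarrow> real" where
  "kernel_op k \<pi> g s = (\<Sum>s'\<in>UNIV. k s (\<pi> s) s' * g s')"

lemma kernel_op_mono: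
  "(\<And>s a s'. 0 \<le> k s a s') \<Longrightarrow> (\<And>s. g s \<le> h s) \<Longrightarrow> kernel_op k \<pi> g s \<le> kernel_op k \<pi> h s"
  unfolding kernel_op_def by (intro sum_mono mult_left_mono) auto

lemma kernel_op_Suc:
  "(kernel_op k \<pi> ^^ Suc t) g s = (\<Sum>s'\<in>UNIV. k s (\<pi> s) s' * (kernel_op k \<pi> ^^ t) g s')"
  by (simp only: funpow.simps comp_apply kernel_op_def[of k \<pi> "(kernel_op k \<pi> ^^ t) g"])

lemma kernel_op_diff: "kernel_op k \<pi> (\<lambda>s. g s - h s) s = kernel_op k \<pi> g s - kernel_op k \<pi> h s"
  by (simp add: kernel_op_def sum_subtractf algebra_simps)

lemma kernel_op_cmult: "kernel_op k \<pi> (\<lambda>s. b * g s) s = b * kernel_op k \<pi> g s"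
  by (simp add: kernel_op_def sum_distrib_left algebra_simps)

text \<open>The inequality \<open>weighted\<close> is uniform in the action, so a single weight
  handles every policy and also the maximum over actions.\<close>

locale contracting_mdp =
  fixes k :: "'s::finite \<Rightarrow> 'a::finite \<Rightarrow> 's \<Rightarrow> real" and w :: "'s \<Rightarrow> real" and \<beta> :: real
    and rb :: "'s \<Rightarrow> 'a \<Rightarrow> real"
  assumes k_nonneg: "\<And>s a s'. 0 \<le> k s a s'"
    and w_pos: "\<And>s. 0 < w s"
    and \<beta>: "0 \<le> \<beta>" "\<beta> < 1"
    and weighted: "\<And>s a. (\<Sum>s'\<in>UNIV. k s a s' * w s') \<le> \<beta> * w s"
begin

text \<open>A maximum principle: at a state maximizing \<open>x s / w s\<close>, a positive maximum
  \<open>m\<close> would satisfy \<open>m \<le> \<beta> * m\<close>.\<close>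

lemma subinvariant_nonpos:
  assumes "\<And>s. x s \<le> kernel_op k \<pi> x s"
  shows "x s \<le> 0"
proof -
  define m where "m = Max (range (\<lambda>s. x s / w s))"
  have "m \<in> range (\<lambda>s. x s / w s)" unfolding m_def by (intro Max_in) auto
  then obtain s0 where s0: "m = x s0 / w s0" by auto
  have m: "x s \<le> m * w s" for s
  proof -
    have "x s / w s \<le> m" unfolding m_def by (intro Max_ge) auto
    then show ?thesis using w_pos[of s] by (simp add: field_simps)
  qed
  have "m \<le> 0"
  proof (rule ccontr)
    assume "\<not> m \<le> 0"
    have "m * w s0 \<le> kernel_op k \<pi> x s0" using assms[of s0] s0 w_pos[of s0] by simp
    also have "\<dots> \<le> kernel_op k \<pi> (\<lambda>s. m * w s) s0" by (rule kernel_op_mono[OF k_nonneg m])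
    also have "\<dots> \<le> m * (\<beta> * w s0)"
      unfolding kernel_op_cmult using \<open>\<not> m \<le> 0\<close> weighted
      by (intro mult_left_mono) (auto simp: kernel_op_def)
    finally have "(1 - \<beta>) * (m * w s0) \<le> 0" by (simp add: algebra_simps)
    moreover have "(1 - \<beta>) * (m * w s0) > 0"
      using \<beta> w_pos[of s0] \<open>\<not> m \<le> 0\<close> by (intro mult_pos_pos) auto
    ultimately show False by simp
  qed
  then have "m * w s \<le> 0" using w_pos[of s] by (simp add: mult_le_0_iff)
  with m[of s] show ?thesis by linarith
qed

lemma kernel_op_power_bound:
  assumes g: "\<And>s. \<bar>g s\<bar> \<le> m * w s"
  shows "\<bar>(kernel_op k \<pi> ^^ t) g s\<bar> \<le> \<beta> ^ t * (m * w s)"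
proof (induction t arbitrary: s)
  case (Suc t)
  have m: "m \<ge> 0"
    using g[of s] w_pos[of s] abs_ge_zero[of "g s"] by (smt (verit) mult_neg_pos)
  have "\<bar>(kernel_op k \<pi> ^^ Suc t) g s\<bar> \<le> (\<Sum>s'\<in>UNIV. k s (\<pi> s) s' * \<bar>(kernel_op k \<pi> ^^ t) g s'\<bar>)"
    unfolding kernel_op_Suc by (rule order_trans[OF sum_abs]) (simp add: abs_mult k_nonneg)
  also have "\<dots> \<le> kernel_op k \<pi> (\<lambda>s. (\<beta> ^ t * m) * w s) s"
    unfolding kernel_op_def[of k \<pi> "\<lambda>s. (\<beta> ^ t * m) * w s"]
    using Suc by (intro sum_mono mult_left_mono k_nonneg) (simp add: mult.assoc)
  also have "\<dots> \<le> (\<beta> ^ t * m) * (\<beta> * w s)"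
    unfolding kernel_op_cmult using weighted m \<beta>
    by (intro mult_left_mono) (auto simp: kernel_op_def)
  finally show ?case by (simp add: algebra_simps)
qed (simp add: g)

text \<open>The Neumann series of the kernel applied to the mean rewards;
  \<open>policy_value_eq_V\<close> identifies it with the value of the policy.\<close>

definition V :: "('s \<Rightarrow> 'a) \<Rightarrow> 's \<Rightarrow> real" where
  "V \<pi> s = (\<Sum>t. (kernel_op k \<pi> ^^ t) (\<lambda>s. rb s (\<pi> s)) s)"

lemma V_summable: "summable (\<lambda>t. (kernel_op k \<pi> ^^ t) g s)"
proof -
  define m where "m = Max (range (\<lambda>s. \<bar>g s\<bar> / w s))"
  have m: "\<bar>g s\<bar> \<le> m * w s" for s
  proof -
    have "\<bar>g s\<bar> / w s \<le> m" unfolding m_def by (intro Max_ge) auto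
    then show ?thesis using w_pos[of s] by (simp add: field_simps)
  qed
  show ?thesis
  proof (rule summable_comparison_test)
    show "\<exists>N. \<forall>t\<ge>N. norm ((kernel_op k \<pi> ^^ t) g s) \<le> \<beta> ^ t * (m * w s)"
      using kernel_op_power_bound[OF m] by simp
    show "summable (\<lambda>t. \<beta> ^ t * (m * w s))"
      using \<beta> by (intro summable_mult2 summable_geometric) simp
  qed
qed

lemma V_equation: "V \<pi> s = rb s (\<pi> s) + kernel_op k \<pi> (V \<pi>) s"
proof -
  let ?g = "\<lambda>s. rb s (\<pi> s)"
  have "V \<pi> s = ?g s + (\<Sum>t. (kernel_op k \<pi> ^^ Suc t) ?g s)"
    unfolding V_def using suminf_split_head[OF V_summable[of \<pi> ?g s]] by simp
  also have "(\<Sum>t. (kernel_op k \<pi> ^^ Suc t) ?g s) = kernel_op k \<pi> (V \<pi>) s"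
    unfolding kernel_op_def[of k \<pi> "V \<pi>"] V_def
    by (subst suminf_mult[symmetric, OF V_summable], subst suminf_sum[symmetric])
       (auto intro!: summable_mult V_summable simp: kernel_op_def)
  finally show ?thesis .
qed

text \<open>Rewards cancel in \<open>x - V \<pi>\<close>, leaving a subinvariant function. With
  \<open>x\<close> the value of another policy this is policy improvement; \<open>V_le\<close> is
  the mirror image.\<close>

lemma V_ge:
  assumes "\<And>s. x s \<le> rb s (\<pi> s) + kernel_op k \<pi> x s"
  shows "x s \<le> V \<pi> s"
proof -
  have "x s - V \<pi> s \<le> 0"
  proof (rule subinvariant_nonpos[where x = "\<lambda>s. x s - V \<pi> s" and \<pi> = \<pi>])
    show "x s - V \<pi> s \<le> kernel_op k \<pi> (\<lambda>s. x s - V \<pi> s) s" for s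
      using assms[of s] V_equation[of \<pi> s] by (simp add: kernel_op_diff)
  qed
  then show ?thesis by simp
qed

lemma V_le:
  assumes "\<And>s. rb s (\<pi> s) + kernel_op k \<pi> x s \<le> x s"
  shows "V \<pi> s \<le> x s"
proof -
  have "V \<pi> s - x s \<le> 0"
  proof (rule subinvariant_nonpos[where x = "\<lambda>s. V \<pi> s - x s" and \<pi> = \<pi>])
    show "V \<pi> s - x s \<le> kernel_op k \<pi> (\<lambda>s. V \<pi> s - x s) s" for s
      using assms[of s] V_equation[of \<pi> s] by (simp add: kernel_op_diff)
  qed
  then show ?thesis by simp
qed

definition Qval :: "('s \<Rightarrow> real) \<Rightarrow> 's \<Rightarrow> 'a \<Rightarrow> real" where
  "Qval v s a = rb s a + (\<Sum>s'\<in>UNIV. k s a s' * v s')"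

text \<open>
  A policy maximizing the total value \<open>\<Sum>s. V \<pi> s\<close> cannot be improved by its greedy policy,
  so its value solves the Bellman equation.
\<close>

lemma bellman: "(SUP \<pi>. V \<pi> s) = (MAX a\<in>UNIV. Qval (\<lambda>s. SUP \<pi>. V \<pi> s) s a)"
proof -
  \<comment> \<open>There are finitely many policies, so the maximum exists; summing over states
    replaces the partial order on values by a total one.\<close>
  obtain \<pi> where \<pi>: "\<And>\<pi>'. (\<Sum>s\<in>UNIV. V \<pi>' s) \<le> (\<Sum>s\<in>UNIV. V \<pi> s)"
  proof -
    have "Max (range (\<lambda>\<pi>. \<Sum>s\<in>UNIV. V \<pi> s)) \<in> range (\<lambda>\<pi>. \<Sum>s\<in>UNIV. V \<pi> s)"
      by (intro Max_in) auto
    then obtain \<pi> where "Max (range (\<lambda>\<pi>. \<Sum>s\<in>UNIV. V \<pi> s)) = (\<Sum>s\<in>UNIV. V \<pi> s)" by blast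
    moreover have "(\<Sum>s\<in>UNIV. V \<pi>' s) \<le> Max (range (\<lambda>\<pi>. \<Sum>s\<in>UNIV. V \<pi> s))" for \<pi>'
      by (intro Max_ge) auto
    ultimately show ?thesis using that by metis
  qed
  have "\<exists>a. Qval (V \<pi>) s a = (MAX a\<in>UNIV. Qval (V \<pi>) s a)" for s
  proof -
    have "(MAX a\<in>UNIV. Qval (V \<pi>) s a) \<in> range (Qval (V \<pi>) s)" by (intro Max_in) auto
    then show ?thesis by (metis rangeE)
  qed
  then obtain \<pi>' where \<pi>': "\<And>s. Qval (V \<pi>) s (\<pi>' s) = (MAX a\<in>UNIV. Qval (V \<pi>) s a)" by metis
  have Q_le: "Qval (V \<pi>) s a \<le> Qval (V \<pi>) s (\<pi>' s)" for s a
    unfolding \<pi>' by (intro Max_ge) auto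
  have Q_\<pi>: "V \<pi> s = Qval (V \<pi>) s (\<pi> s)" for s
    using V_equation[of \<pi> s] by (simp add: Qval_def kernel_op_def)
  have better: "V \<pi> s \<le> V \<pi>' s" for s
  proof (rule V_ge)
    show "V \<pi> s \<le> rb s (\<pi>' s) + kernel_op k \<pi>' (V \<pi>) s" for s
      using Q_\<pi>[of s] Q_le[of s "\<pi> s"] by (simp add: Qval_def kernel_op_def)
  qed
  \<comment> \<open>The greedy policy dominates statewise but cannot have a larger total, so all
    differences vanish.\<close>
  have eq: "V \<pi>' = V \<pi>"
  proof
    fix s
    have "(\<Sum>s\<in>UNIV. V \<pi>' s - V \<pi> s) = 0"
      using \<pi>[of \<pi>'] sum_mono[of UNIV "V \<pi>" "V \<pi>'"] better by (simp add: sum_subtractf)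
    then show "V \<pi>' s = V \<pi> s"
      using sum_nonneg_eq_0_iff[of UNIV "\<lambda>s. V \<pi>' s - V \<pi> s"] better by simp
  qed
  have fixed: "V \<pi> s = (MAX a\<in>UNIV. Qval (V \<pi>) s a)" for s
    using V_equation[of \<pi>' s] unfolding eq \<pi>'[symmetric] by (simp add: Qval_def kernel_op_def)
  have "V \<pi>'' s \<le> V \<pi> s" for \<pi>'' s
  proof (rule V_le)
    show "rb s (\<pi>'' s) + kernel_op k \<pi>'' (V \<pi>) s \<le> V \<pi> s" for s
      using Q_le[of s "\<pi>'' s"] unfolding fixed[of s] \<pi>' by (simp add: Qval_def kernel_op_def)
  qed
  then have "(SUP \<pi>. V \<pi> s) = V \<pi> s" for s
    by (intro cSup_eq_maximum) auto
  then show ?thesis using fixed[of s] by (simp only:)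
qed

end

section \<open>Finite-horizon returns as powers of the transition operator\<close>

lemma expectation_pmf_finite:
  fixes g :: "'s::finite \<Rightarrow> real"
  shows "measure_pmf.expectation q g = (\<Sum>s'\<in>UNIV. pmf q s' * g s')"
  by (subst integral_measure_pmf_real[of UNIV]) (auto simp: mult.commute)

lemma finite_set_pmf_chain_path: "finite (set_pmf (chain_path p \<pi> s T))"
  for p :: "'s::finite \<Rightarrow> 'a \<Rightarrow> 's pmf"
  by (induction T) auto

lemma length_chain_path: "xs \<in> set_pmf (chain_path p \<pi> s T) \<Longrightarrow> length xs = Suc T"
  by (induction T arbitrary: xs) auto

lemma expectation_chain_path_Suc:
  fixes p :: "'s::finite \<Rightarrow> 'a \<Rightarrow> 's pmf" and H :: "'s list \<Rightarrow> real"
  shows "measure_pmf.expectation (chain_path p \<pi> s (Suc T)) H =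
    measure_pmf.expectation (chain_path p \<pi> s T)
      (\<lambda>xs. \<Sum>s'\<in>UNIV. pmf (p (last xs) (\<pi> (last xs))) s' * H (xs @ [s']))"
proof -
  have "measure_pmf.expectation (chain_path p \<pi> s (Suc T)) H =
    (\<Sum>xs\<in>set_pmf (chain_path p \<pi> s T). pmf (chain_path p \<pi> s T) xs *
      measure_pmf.expectation (map_pmf (\<lambda>s'. xs @ [s']) (p (last xs) (\<pi> (last xs)))) H)"
    by (simp, subst pmf_expectation_bind[OF finite_set_pmf_chain_path]) auto
  also have "\<dots> = measure_pmf.expectation (chain_path p \<pi> s T)
      (\<lambda>xs. \<Sum>s'\<in>UNIV. pmf (p (last xs) (\<pi> (last xs))) s' * H (xs @ [s']))"
    by (subst integral_measure_pmf[OF finite_set_pmf_chain_path]) (auto simp: expectation_pmf_finite)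
  finally show ?thesis .
qed

text \<open>Paths grow at the end, so the last transition is applied to \<open>g\<close> first; this
  is why the induction varies \<open>g\<close> and unfolds the power from the right.\<close>

lemma expectation_chain_path_last:
  fixes p :: "'s::finite \<Rightarrow> 'a \<Rightarrow> 's pmf"
  shows "measure_pmf.expectation (chain_path p \<pi> s T) (\<lambda>xs. g (last xs)) =
    (kernel_op (\<lambda>s a s'. pmf (p s a) s') \<pi> ^^ T) g s"
proof (induction T arbitrary: g)
  case (Suc T)
  have "measure_pmf.expectation (chain_path p \<pi> s (Suc T)) (\<lambda>xs. g (last xs)) =
    measure_pmf.expectation (chain_path p \<pi> s T)
      (\<lambda>xs. kernel_op (\<lambda>s a s'. pmf (p s a) s') \<pi> g (last xs))"
    by (simp only: expectation_chain_path_Suc) (simp add: kernel_op_def)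
  then show ?case by (simp only: Suc funpow_Suc_right comp_apply)
qed simp

text \<open>Given the path, each reward is a coordinate of a product of probability measures, so
  only its mean survives integration. Extending the path then adds one power of the
  operator.\<close>

lemma expected_return_eq:
  fixes p :: "'s::finite \<Rightarrow> 'a \<Rightarrow> 's pmf"
  assumes R: "\<And>s a. reward_law (R s a)"
  shows "expected_return p R \<gamma> \<pi> s T =
    (\<Sum>t\<le>T. \<gamma> ^ t * (kernel_op (\<lambda>s a s'. pmf (p s a) s') \<pi> ^^ t) (\<lambda>s. \<integral>x. x \<partial>(R s (\<pi> s))) s)"
proof -
  define rb where "rb s = (\<integral>x. x \<partial>(R s (\<pi> s)))" for s
  have inner: "(\<integral>w. (\<Sum>t\<le>T. \<gamma> ^ t * w t) \<partial>(\<Pi>\<^sub>M t\<in>{..T}. R (xs ! t) (\<pi> (xs ! t)))) =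
    (\<Sum>t\<le>T. \<gamma> ^ t * rb (xs ! t))" for xs and T :: nat
  proof -
    let ?D = "\<lambda>t. R (xs ! t) (\<pi> (xs ! t))"
    have comp: "integrable (Pi\<^sub>M {..T} ?D) (\<lambda>w. w t) \<and> (\<integral>w. w t \<partial>(Pi\<^sub>M {..T} ?D)) = rb (xs ! t)"
      if "t \<in> {..T}" for t
    proof -
      have D: "distr (Pi\<^sub>M {..T} ?D) (?D t) (\<lambda>w. w t) = ?D t"
        using R that by (intro distr_PiM_component) (auto simp: reward_law_def)
      have int: "integrable (?D t) (\<lambda>x. x)" and sets: "sets (?D t) = sets borel"
        using R by (auto simp: reward_law_def)
      have M: "(\<lambda>w. w t) \<in> measurable (Pi\<^sub>M {..T} ?D) (?D t)"
        using that by (intro measurable_component_singleton)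
      have id: "(\<lambda>x. x) \<in> borel_measurable (?D t)"
        using int by (rule borel_measurable_integrable)
      have "integrable (distr (Pi\<^sub>M {..T} ?D) (?D t) (\<lambda>w. w t)) (\<lambda>x. x)" using int D by simp
      then have "integrable (Pi\<^sub>M {..T} ?D) (\<lambda>w. w t)"
        by (subst (asm) integrable_distr_eq[OF M id]) simp
      moreover have "rb (xs ! t) = (\<integral>x. x \<partial>(distr (Pi\<^sub>M {..T} ?D) (?D t) (\<lambda>w. w t)))"
        by (simp add: D rb_def)
      ultimately show ?thesis by (simp add: integral_distr[OF M id])
    qed
    show ?thesis using comp by (subst Bochner_Integration.integral_sum) auto
  qed
  have "measure_pmf.expectation (chain_path p \<pi> s T) (\<lambda>xs. \<Sum>t\<le>T. \<gamma> ^ t * rb (xs ! t)) =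
    (\<Sum>t\<le>T. \<gamma> ^ t * (kernel_op (\<lambda>s a s'. pmf (p s a) s') \<pi> ^^ t) rb s)"
  proof (induction T)
    case (Suc T)
    let ?P = "chain_path p \<pi> s T"
    let ?K = "kernel_op (\<lambda>s a s'. pmf (p s a) s') \<pi>"
    have "measure_pmf.expectation (chain_path p \<pi> s (Suc T)) (\<lambda>xs. \<Sum>t\<le>Suc T. \<gamma> ^ t * rb (xs ! t)) =
      measure_pmf.expectation ?P (\<lambda>xs. \<Sum>s'\<in>UNIV. pmf (p (last xs) (\<pi> (last xs))) s' *
        (\<Sum>t\<le>Suc T. \<gamma> ^ t * rb ((xs @ [s']) ! t)))"
      by (rule expectation_chain_path_Suc)
    also have "\<dots> = measure_pmf.expectation ?P
        (\<lambda>xs. (\<Sum>t\<le>T. \<gamma> ^ t * rb (xs ! t)) + \<gamma> ^ Suc T * ?K rb (last xs))"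
    \<comment> \<open>Paths up to \<open>T\<close> have length \<open>Suc T\<close>, so position
      \<open>Suc T\<close> of the extended path is exactly the new state.\<close>
    proof (intro integral_cong_AE AE_pmfI)
      fix xs assume "xs \<in> set_pmf ?P"
      then have len: "length xs = Suc T" by (rule length_chain_path)
      have "(\<Sum>t\<le>T. \<gamma> ^ t * rb ((xs @ [s']) ! t)) = (\<Sum>t\<le>T. \<gamma> ^ t * rb (xs ! t))" for s'
        using len by (intro sum.cong) (auto simp: nth_append)
      moreover have "(xs @ [s']) ! Suc T = s'" for s' using len by (simp add: nth_append)
      ultimately show "(\<Sum>s'\<in>UNIV. pmf (p (last xs) (\<pi> (last xs))) s' *
        (\<Sum>t\<le>Suc T. \<gamma> ^ t * rb ((xs @ [s']) ! t))) =
        (\<Sum>t\<le>T. \<gamma> ^ t * rb (xs ! t)) + \<gamma> ^ Suc T * ?K rb (last xs)"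
        by (simp add: kernel_op_def distrib_left sum.distrib sum_distrib_right[symmetric]
            sum_pmf_eq_1) (simp add: sum_distrib_left mult.left_commute)
    qed auto
    also have "\<dots> = measure_pmf.expectation ?P (\<lambda>xs. \<Sum>t\<le>T. \<gamma> ^ t * rb (xs ! t)) +
        \<gamma> ^ Suc T * measure_pmf.expectation ?P (\<lambda>xs. ?K rb (last xs))"
      by (subst Bochner_Integration.integral_add)
        (auto intro!: integrable_measure_pmf_finite finite_set_pmf_chain_path)
    also have "measure_pmf.expectation ?P (\<lambda>xs. ?K rb (last xs)) = (?K ^^ Suc T) rb s"
      by (simp only: expectation_chain_path_last funpow_Suc_right comp_apply)
    finally show ?case using Suc by simp
  qed simp
  then show ?thesis unfolding expected_return_def inner by (simp only: rb_def[abs_def])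
qed

text \<open>
  Dropping the transitions into a set \<open>Z\<close> of absorbing reward-free states changes no policy value,
  and makes the kernel contract a weighted supremum norm also for \<open>\<gamma> = 1\<close>.
\<close>

definition transient_kernel ::
  "('s \<Rightarrow> 'a \<Rightarrow> 's pmf) \<Rightarrow> real \<Rightarrow> 's set \<Rightarrow> 's \<Rightarrow> 'a \<Rightarrow> 's \<Rightarrow> real" where
  "transient_kernel p \<gamma> Z s a s' = (if s' \<in> Z then 0 else \<gamma>) * pmf (p s a) s'"

lemma pmf_absorbing:
  assumes "pmf q s = 1" shows "pmf q s' = (if s' = s then 1 else 0)"
proof -
  have "q = return_pmf s"
    using assms by (metis measure_pmf_single measure_pmf.prob_eq_1 AE_measure_pmf_iff sets_measure_pmf UNIV_I set_pmf_subset_singleton subsetI insertI1 singletonD)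
  then show ?thesis by (simp add: indicator_def pmf_return)
qed

text \<open>The kernels differ only on transitions into \<open>Z\<close>, where the iterates of
  \<open>g\<close> vanish because absorbing states keep the value 0; hence the simultaneous
  induction.\<close>

lemma transient_kernel_power:
  fixes p :: "'s::finite \<Rightarrow> 'a \<Rightarrow> 's pmf"
  assumes Z: "\<And>z a. z \<in> Z \<Longrightarrow> pmf (p z a) z = 1" and g: "\<And>z. z \<in> Z \<Longrightarrow> g z = 0"
  shows "(kernel_op (transient_kernel p \<gamma> Z) \<pi> ^^ t) g s =
      \<gamma> ^ t * (kernel_op (\<lambda>s a s'. pmf (p s a) s') \<pi> ^^ t) g s"
    and "s \<in> Z \<Longrightarrow> (kernel_op (\<lambda>s a s'. pmf (p s a) s') \<pi> ^^ t) g s = 0"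
proof (induction t arbitrary: s)
  case (Suc t)
  {
    case 1
    show ?case
      unfolding kernel_op_Suc Suc(1) sum_distrib_left
      using Suc(2) by (intro sum.cong) (auto simp: transient_kernel_def)
  next
    case 2
    then have "(kernel_op (\<lambda>s a s'. pmf (p s a) s') \<pi> ^^ Suc t) g s =
      (\<Sum>s'\<in>UNIV. (if s' = s then 1 else 0) * (kernel_op (\<lambda>s a s'. pmf (p s a) s') \<pi> ^^ t) g s')"
      unfolding kernel_op_Suc using pmf_absorbing[OF Z[OF 2]] by simp
    then show ?case using Suc(2)[OF 2] by (simp add: if_distrib if_distribR cong: if_cong)
  }
qed (use g in auto)

text \<open>Common frame for both cases of the theorem: \<open>Z\<close> is empty for
  \<open>\<gamma> < 1\<close> and \<open>{s\<^sub>1}\<close> for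
  \<open>\<gamma> = 1\<close>.\<close>

locale transient_mdp =
  contracting_mdp "transient_kernel p \<gamma> Z" w \<beta> "\<lambda>s a. \<integral>x. x \<partial>(R s a)"
  for p :: "'s::finite \<Rightarrow> 'a::finite \<Rightarrow> 's pmf" and R :: "'s \<Rightarrow> 'a \<Rightarrow> real measure"
    and \<gamma> \<beta> :: real and Z :: "'s set" and w :: "'s \<Rightarrow> real" +
  assumes reward_law: "\<And>s a. reward_law (R s a)"
    and absorbing: "\<And>z. z \<in> Z \<Longrightarrow> absorbing_reward_free p R z"
begin

abbreviation mean_reward :: "'s \<Rightarrow> 'a \<Rightarrow> real" where
  "mean_reward s a \<equiv> \<integral>x. x \<partial>(R s a)"

lemma pmf_Z: "z \<in> Z \<Longrightarrow> pmf (p z a) z = 1"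
  using absorbing by (auto simp: absorbing_reward_free_def)

lemma mean_reward_Z: "z \<in> Z \<Longrightarrow> mean_reward z a = 0"
  using absorbing[of z] by (intro integral_eq_zero_AE) (auto simp: absorbing_reward_free_def)

text \<open>The series for \<open>V\<close> converges, so the \<open>lim\<close> in the value of a
  policy is a genuine limit here.\<close>

lemma policy_value_eq_V: "policy_value p R \<gamma> \<pi> s = V \<pi> s"
  unfolding policy_value_def expected_return_eq[OF reward_law]
  unfolding V_def
  using summable_LIMSEQ'[OF V_summable[of \<pi> "\<lambda>s. mean_reward s (\<pi> s)" s]]
  by (intro limI) (simp add: transient_kernel_power(1)[OF pmf_Z mean_reward_Z])

lemma V_Z: "z \<in> Z \<Longrightarrow> V \<pi> z = 0"
  unfolding V_def
  by (simp add: transient_kernel_power[OF pmf_Z mean_reward_Z])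

lemma optimal_value_Z: "z \<in> Z \<Longrightarrow> optimal_value p R \<gamma> z = 0"
  by (simp add: optimal_value_def policy_value_eq_V V_Z)

lemma optimal_Q_eq:
  "optimal_Q p R \<gamma> s a =
    mean_reward s a + (\<Sum>s'\<in>UNIV. transient_kernel p \<gamma> Z s a s' * optimal_value p R \<gamma> s')"
  unfolding optimal_Q_def sum_distrib_left
  using optimal_value_Z by (intro arg_cong2[where f = "(+)"] sum.cong) (auto simp: transient_kernel_def)

lemma optimal_value_eq_Max: "optimal_value p R \<gamma> s = (MAX a\<in>UNIV. optimal_Q p R \<gamma> s a)"
  using bellman[of s] unfolding optimal_Q_eq Qval_def optimal_value_def policy_value_eq_V .

end

text \<open>
  With \<open>q t s\<close> the largest probability, over Markov policies, of avoiding \<open>s\<^sub>1\<close> up to time \<open>t\<close>,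
  a limit of \<open>q\<close> is subinvariant under the greedy stationary policy and hence vanishes by properness.
  The weights are then the partial sums of \<open>q\<close> up to a time \<open>n\<close> at which \<open>q n \<le> 1 / 2\<close>.
\<close>

lemma proper_weights:
  fixes p :: "'s::finite \<Rightarrow> 'a::finite \<Rightarrow> 's pmf"
  assumes abs: "\<And>a. pmf (p s\<^sub>1 a) s\<^sub>1 = 1" and proper: "\<And>\<pi>. proper_policy p s\<^sub>1 \<pi>"
  shows "\<exists>w \<beta>. 0 \<le> \<beta> \<and> \<beta> < 1 \<and> (\<forall>s. 0 < w s) \<and>
    (\<forall>s a. (\<Sum>s'\<in>UNIV. transient_kernel p 1 {s\<^sub>1} s a s' * w s') \<le> \<beta> * w s)"
proof -
  let ?P = "\<lambda>s a s'. pmf (p s a) s'"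
  define q0 where "q0 s = (if s = s\<^sub>1 then 0 else 1::real)" for s
  define q where "q t = ((\<lambda>g s. MAX a\<in>UNIV. \<Sum>s'\<in>UNIV. pmf (p s a) s' * g s') ^^ t) q0" for t
  have q_0: "q 0 = q0" by (simp add: q_def)
  have q_Suc: "q (Suc t) s = (MAX a\<in>UNIV. \<Sum>s'\<in>UNIV. pmf (p s a) s' * q t s')" for t s
    by (simp add: q_def)
  have q_ge: "(\<Sum>s'\<in>UNIV. pmf (p s a) s' * q t s') \<le> q (Suc t) s" for t s a
    unfolding q_Suc by (intro Max_ge) auto
  have q_le: "q (Suc t) s \<le> b" if "\<And>a. (\<Sum>s'\<in>UNIV. pmf (p s a) s' * q t s') \<le> b" for t s b
    unfolding q_Suc using that by (intro Max.boundedI) auto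
  have q_dec: "q (Suc t) s \<le> q t s" for t s
  proof (induction t arbitrary: s)
    case 0
    show ?case
    proof (cases "s = s\<^sub>1")
      case True
      have "(\<Sum>s'\<in>UNIV. pmf (p s a) s' * q 0 s') = 0" for a
        unfolding True q_0 q0_def pmf_absorbing[OF abs] by (intro sum.neutral) simp
      then show ?thesis by (intro q_le) (simp add: True q_0 q0_def)
    next
      case False
      have "(\<Sum>s'\<in>UNIV. pmf (p s a) s' * q 0 s') \<le> 1" for a
      proof -
        have "(\<Sum>s'\<in>UNIV. pmf (p s a) s' * q 0 s') \<le> (\<Sum>s'\<in>UNIV. pmf (p s a) s')"
          by (intro sum_mono mult_left_le) (auto simp: q_0 q0_def)
        then show ?thesis by (simp add: sum_pmf_eq_1)
      qed
      then show ?thesis using False by (intro q_le) (simp add: q_0 q0_def)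
    qed
  next
    case (Suc t)
    have "(\<Sum>s'\<in>UNIV. pmf (p s a) s' * q (Suc t) s') \<le> (\<Sum>s'\<in>UNIV. pmf (p s a) s' * q t s')" for a
      by (intro sum_mono mult_left_mono Suc) auto
    from order_trans[OF this q_ge] show ?case by (rule q_le)
  qed
  have q_nonneg: "0 \<le> q t s" for t s
  proof (induction t arbitrary: s)
    case (Suc t)
    have "0 \<le> (\<Sum>s'\<in>UNIV. pmf (p s undefined) s' * q t s')"
      by (intro sum_nonneg mult_nonneg_nonneg Suc) auto
    also have "\<dots> \<le> q (Suc t) s" by (rule q_ge)
    finally show ?case .
  qed (simp add: q_0 q0_def)
  have dec: "decseq (\<lambda>t. q t s)" for s
    using q_dec by (intro decseq_SucI)
  have "\<exists>L. (\<lambda>t. q t s) \<longlonglongrightarrow> L" for s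
    using decseq_convergent[OF dec, of 0 s] q_nonneg by metis
  then obtain l where l: "\<And>s. (\<lambda>t. q t s) \<longlonglongrightarrow> l s" by metis
  have l_le: "l s \<le> q t s" for t s
    using decseq_ge[OF dec l] .
  \<comment> \<open>Otherwise each action falls strictly below \<open>l s\<close> eventually, and
    finitely many actions share such a time \<open>t\<close>; then \<open>q (Suc t) s < l s\<close>,
    against monotone convergence from above.\<close>
  have "\<exists>a. l s \<le> (\<Sum>s'\<in>UNIV. pmf (p s a) s' * l s')" for s
  proof (rule ccontr)
    assume "\<not> ?thesis"
    then have "eventually (\<lambda>t. (\<Sum>s'\<in>UNIV. pmf (p s a) s' * q t s') < l s) sequentially" for a
      by (intro order_tendstoD[of _ "\<Sum>s'\<in>UNIV. pmf (p s a) s' * l s'"] tendsto_intros l)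
        (simp add: not_le)
    then have "eventually (\<lambda>t. \<forall>a\<in>UNIV. (\<Sum>s'\<in>UNIV. pmf (p s a) s' * q t s') < l s) sequentially"
      by (intro eventually_ball_finite) auto
    then obtain t where t: "\<And>a. (\<Sum>s'\<in>UNIV. pmf (p s a) s' * q t s') < l s"
      by (auto simp: eventually_sequentially)
    have "q (Suc t) s < l s" unfolding q_Suc using t by (subst Max_less_iff) auto
    then show False using l_le[of s "Suc t"] by simp
  qed
  then obtain \<pi> where \<pi>: "\<And>s. l s \<le> (\<Sum>s'\<in>UNIV. pmf (p s (\<pi> s)) s' * l s')" by metis
  have l_iter: "l s \<le> (kernel_op ?P \<pi> ^^ t) q0 s" for t s
  proof (induction t arbitrary: s)
    case 0
    then show ?case using l_le[of s 0] by (simp add: q_0)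
  next
    case (Suc t)
    show ?case
      unfolding kernel_op_Suc
      by (intro order_trans[OF \<pi> sum_mono] mult_left_mono Suc) auto
  qed
  \<comment> \<open>\<open>q0\<close> indicates the states other than \<open>s\<^sub>1\<close>, so
    its iterates are the probabilities of not being absorbed, which properness sends to 0.\<close>
  have "(kernel_op ?P \<pi> ^^ t) q0 s = 1 - measure_pmf.prob (chain_path p \<pi> s t) {xs. xs ! t = s\<^sub>1}" for t s
  proof -
    have "(kernel_op ?P \<pi> ^^ t) q0 s = measure_pmf.expectation (chain_path p \<pi> s t) (\<lambda>xs. q0 (last xs))"
      by (rule expectation_chain_path_last[symmetric])
    also have "\<dots> = measure_pmf.expectation (chain_path p \<pi> s t)
        (\<lambda>xs. 1 - indicator {xs. xs ! t = s\<^sub>1} xs)"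
    proof (intro integral_cong_AE AE_pmfI)
      fix xs assume "xs \<in> set_pmf (chain_path p \<pi> s t)"
      then have len: "length xs = Suc t" by (rule length_chain_path)
      then have "last xs = xs ! t" by (subst last_conv_nth) auto
      then show "q0 (last xs) = 1 - indicator {xs. xs ! t = s\<^sub>1} xs" by (simp add: q0_def)
    qed auto
    also have "\<dots> = 1 - measure_pmf.prob (chain_path p \<pi> s t) {xs. xs ! t = s\<^sub>1}"
      by (subst Bochner_Integration.integral_diff)
        (auto intro!: integrable_measure_pmf_finite finite_set_pmf_chain_path)
    finally show ?thesis .
  qed
  moreover have "(\<lambda>t. 1 - measure_pmf.prob (chain_path p \<pi> s t) {xs. xs ! t = s\<^sub>1}) \<longlonglongrightarrow> 1 - 1" for s
    using proper[of \<pi>] by (intro tendsto_intros) (auto simp: proper_policy_def)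
  ultimately have lim: "(\<lambda>t. (kernel_op ?P \<pi> ^^ t) q0 s) \<longlonglongrightarrow> 0" for s by simp
  have "l s \<le> 0" for s
    by (rule LIMSEQ_le_const[OF lim]) (use l_iter in blast)
  then have "eventually (\<lambda>t. q t s < 1 / 2) sequentially" for s
    by (intro order_tendstoD[OF l]) (rule le_less_trans[of _ 0], auto)
  then have "eventually (\<lambda>t. \<forall>s\<in>UNIV. q t s < 1 / 2) sequentially"
    by (intro eventually_ball_finite) auto
  from eventually_conj[OF this eventually_gt_at_top[of 0]]
  obtain n where n: "\<And>s. q n s < 1 / 2" "n > 0"
    by (auto simp: eventually_sequentially)
  \<comment> \<open>At \<open>s\<^sub>1\<close> the sum would be 0; the value 1 keeps the weight
    positive and is harmless because the kernel omits transitions into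
    \<open>s\<^sub>1\<close>.\<close>
  define w where "w s = (if s = s\<^sub>1 then 1 else \<Sum>t<n. q t s)" for s
  \<comment> \<open>One transition shifts the sum by one index and loses
    \<open>q 0 s - q n s \<ge> 1 / 2\<close>; since \<open>w s \<le> n\<close>, this is at least the
    fraction \<open>1 / (2 * n)\<close> of \<open>w s\<close>.\<close>
  define \<beta> where "\<beta> = 1 - 1 / (2 * real n)"
  have \<beta>: "0 \<le> \<beta>" "\<beta> < 1" using n(2) by (auto simp: \<beta>_def field_simps)
  have q0_1: "q 0 s = 1" if "s \<noteq> s\<^sub>1" for s using that by (simp add: q_0 q0_def)
  have w_ge: "1 \<le> w s" for s
  proof (cases "s = s\<^sub>1")
    case False
    have "q 0 s \<le> (\<Sum>t<n. q t s)" using n(2) q_nonneg by (intro member_le_sum) auto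
    then show ?thesis using False q0_1 by (simp add: w_def)
  qed (simp add: w_def)
  have w_le: "w s \<le> n" for s
  proof (cases "s = s\<^sub>1")
    case False
    have "q t s \<le> 1" for t
      using decseqD[OF dec, of 0 t s] q0_1[OF False] by simp
    then have "(\<Sum>t<n. q t s) \<le> (\<Sum>t<n. 1)" by (intro sum_mono)
    then show ?thesis using False by (simp add: w_def)
  qed (use n in \<open>simp add: w_def\<close>)
  have "(\<Sum>s'\<in>UNIV. transient_kernel p 1 {s\<^sub>1} s a s' * w s') \<le> \<beta> * w s" for s a
  proof (cases "s = s\<^sub>1")
    case True
    have "(\<Sum>s'\<in>UNIV. transient_kernel p 1 {s\<^sub>1} s a s' * w s') = 0"
      using True by (intro sum.neutral) (auto simp: transient_kernel_def pmf_absorbing[OF abs])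
    then show ?thesis using \<beta> w_ge[of s] by simp
  next
    case False
    have "(\<Sum>s'\<in>UNIV. transient_kernel p 1 {s\<^sub>1} s a s' * w s')
        \<le> (\<Sum>s'\<in>UNIV. pmf (p s a) s' * (\<Sum>t<n. q t s'))"
      by (intro sum_mono) (auto simp: transient_kernel_def w_def intro!: mult_nonneg_nonneg sum_nonneg q_nonneg)
    also have "\<dots> = (\<Sum>t<n. \<Sum>s'\<in>UNIV. pmf (p s a) s' * q t s')"
      unfolding sum_distrib_left by (rule sum.swap)
    also have "\<dots> \<le> (\<Sum>t<n. q (Suc t) s)" by (intro sum_mono q_ge)
    also have "\<dots> = (\<Sum>t<n. q t s) + q n s - q 0 s"
      using sum.lessThan_Suc_shift[of "\<lambda>t. q t s" n] by simp
    also have "\<dots> \<le> w s - 1 / 2" using n(1)[of s] q0_1 False by (simp add: w_def)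
    also have "\<dots> \<le> \<beta> * w s"
      using w_le[of s] n(2) by (simp add: \<beta>_def field_simps)
    finally show ?thesis .
  qed
  moreover have "0 < w s" for s using w_ge[of s] by linarith
  ultimately show ?thesis using \<beta> by blast
qed

subsection \<open>Maxmin Q-learning\<close>

text \<open>Every other state-action pair is tested on the whole space and contributes a factor
  1.\<close>

lemma fresh_samples_marginal:
  fixes p :: "'s::finite \<Rightarrow> 'a::finite \<Rightarrow> 's pmf"
  assumes fresh: "fresh_samples M G p R \<rho> \<phi>" and laws: "\<And>s a. reward_law (R s a)"
    and E: "E \<in> sets G" and B: "B \<in> sets borel"
  shows "measure M (E \<inter> {\<omega>\<in>space M. \<rho> s a \<omega> \<in> B \<and> \<phi> s a \<omega> \<in> X}) =
    measure M E * (measure (R s a) B * measure_pmf.prob (p s a) X)"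
proof -
  define B' where "B' s' a' = (if s' = s \<and> a' = a then B else UNIV)" for s' a'
  define X' where "X' s' a' = (if s' = s \<and> a' = a then X else UNIV)" for s' a'
  have "measure (R s a) UNIV = 1" for s a
  proof -
    have "prob_space (R s a)" "sets (R s a) = sets borel"
      using laws by (auto simp: reward_law_def)
    then show ?thesis
      using prob_space.prob_space[of "R s a"] sets_eq_imp_space_eq[of "R s a" borel] by simp
  qed
  then have "(\<Prod>s'\<in>UNIV. \<Prod>a'\<in>UNIV. measure (R s' a') (B' s' a') * measure_pmf.prob (p s' a') (X' s' a')) =
    (\<Prod>s'\<in>UNIV. \<Prod>a'\<in>UNIV. if s' = s \<and> a' = a then measure (R s a) B * measure_pmf.prob (p s a) X else 1)"
    by (intro prod.cong refl) (auto simp: B'_def X'_def)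
  also have "\<dots> = (\<Prod>s'\<in>UNIV. if s' = s then measure (R s a) B * measure_pmf.prob (p s a) X else 1)"
    by (intro prod.cong refl) auto
  also have "\<dots> = measure (R s a) B * measure_pmf.prob (p s a) X" by simp
  finally have 1: "(\<Prod>s'\<in>UNIV. \<Prod>a'\<in>UNIV. measure (R s' a') (B' s' a') * measure_pmf.prob (p s' a') (X' s' a')) =
    measure (R s a) B * measure_pmf.prob (p s a) X" .
  have "{\<omega>\<in>space M. \<forall>s' a'. \<rho> s' a' \<omega> \<in> B' s' a' \<and> \<phi> s' a' \<omega> \<in> X' s' a'} =
    {\<omega>\<in>space M. \<rho> s a \<omega> \<in> B \<and> \<phi> s a \<omega> \<in> X}"
    by (auto simp: B'_def X'_def split: if_splits)
  moreover have "measure M (E \<inter> {\<omega>\<in>space M. \<forall>s' a'. \<rho> s' a' \<omega> \<in> B' s' a' \<and> \<phi> s' a' \<omega> \<in> X' s' a'}) =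
      measure M E * (\<Prod>s'\<in>UNIV. \<Prod>a'\<in>UNIV. measure (R s' a') (B' s' a') * measure_pmf.prob (p s' a') (X' s' a'))"
    by (rule fresh[unfolded fresh_samples_def, rule_format, OF E]) (use B in \<open>simp add: B'_def\<close>)
  ultimately show ?thesis by (simp only: 1)
qed

text \<open>All estimators are compared with the same \<open>y\<close>, so the minimum over them
  stays within \<open>b\<close> of \<open>y a\<close> and the disagreement between estimators never
  enters.\<close>

lemma dist_Max_Min_le:
  fixes x :: "'i \<Rightarrow> 'a::finite \<Rightarrow> real"
  assumes I: "finite I" "I \<noteq> {}" and le: "\<And>i a. i \<in> I \<Longrightarrow> \<bar>x i a - y a\<bar> \<le> b"
  shows "\<bar>(MAX a\<in>UNIV. MIN i\<in>I. x i a) - (MAX a\<in>UNIV. y a)\<bar> \<le> b"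
proof -
  have Min: "y a - b \<le> (MIN i\<in>I. x i a)" "(MIN i\<in>I. x i a) \<le> y a + b" for a
  proof -
    show "y a - b \<le> (MIN i\<in>I. x i a)"
    proof -
      have "y a - b \<le> x i a" if "i \<in> I" for i using le[OF that, of a] by linarith
      then show ?thesis using I by (intro Min.boundedI) auto
    qed
    obtain i where "i \<in> I" using I by blast
    then have "(MIN i\<in>I. x i a) \<le> x i a" using I by (intro Min_le) auto
    then show "(MIN i\<in>I. x i a) \<le> y a + b" using le[OF \<open>i \<in> I\<close>, of a] by linarith
  qed
  have "(MIN i\<in>I. x i a) \<le> (MAX a\<in>UNIV. y a) + b" for a
  proof -
    have "y a \<le> (MAX a\<in>UNIV. y a)" by (intro Max_ge) auto
    then show ?thesis using Min[of a] by linarith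
  qed
  then have "(MAX a\<in>UNIV. MIN i\<in>I. x i a) \<le> (MAX a\<in>UNIV. y a) + b"
    by (subst Max_le_iff) auto
  moreover have "y a \<le> (MAX a\<in>UNIV. MIN i\<in>I. x i a) + b" for a
  proof -
    have "(MIN i\<in>I. x i a) \<le> (MAX a\<in>UNIV. MIN i\<in>I. x i a)" by (intro Max_ge) auto
    then show ?thesis using Min[of a] by linarith
  qed
  then have "(MAX a\<in>UNIV. y a) \<le> (MAX a\<in>UNIV. MIN i\<in>I. x i a) + b"
    by (subst Max_le_iff) auto
  ultimately show ?thesis by linarith
qed

locale maxmin_Q_learning = prob_space M + transient_mdp p R \<gamma> \<beta> Z w
  for M :: "'w measure" and p :: "'s::finite \<Rightarrow> 'a::finite \<Rightarrow> 's pmf"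
    and R :: "'s \<Rightarrow> 'a \<Rightarrow> real measure" and \<gamma> \<beta> :: real and Z :: "'s set" and w :: "'s \<Rightarrow> real" +
  fixes F :: "nat \<Rightarrow> 'w measure" and C :: real and N :: nat
    and Q :: "nat \<Rightarrow> 's \<Rightarrow> 'a \<Rightarrow> nat \<Rightarrow> 'w \<Rightarrow> real"
    and \<alpha> :: "nat \<Rightarrow> 's \<Rightarrow> 'a \<Rightarrow> nat \<Rightarrow> 'w \<Rightarrow> real"
    and r :: "'s \<Rightarrow> 'a \<Rightarrow> nat \<Rightarrow> 'w \<Rightarrow> real"
    and f :: "'s \<Rightarrow> 'a \<Rightarrow> nat \<Rightarrow> 'w \<Rightarrow> 's"
  assumes discount: "0 \<le> \<gamma>" "\<gamma> \<le> 1"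
    and estimators: "1 \<le> N"
    and history: "filtration (space M) F" "\<And>t. subalgebra M (F t)"
    and Q_init_meas: "\<And>i s a. i \<in> {1..N} \<Longrightarrow> Q i s a 0 \<in> borel_measurable (F 0)"
    and step_meas: "\<And>i s a t. i \<in> {1..N} \<Longrightarrow> \<alpha> i s a t \<in> borel_measurable (F t)"
    and reward_meas: "\<And>s a t. r s a t \<in> borel_measurable (F (Suc t))"
    and successor_meas: "\<And>s a t. f s a t \<in> measurable (F (Suc t)) (count_space UNIV)"
    and samples: "\<And>t. fresh_samples M (F t) p R (\<lambda>s a. r s a t) (\<lambda>s a. f s a t)"
    and iteration: "\<And>i s a t \<omega>. i \<in> {1..N} \<Longrightarrow> \<omega> \<in> space M \<Longrightarrow>
      Q i s a (Suc t) \<omega> = Q i s a t \<omega> + \<alpha> i s a t \<omega> *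
        (r s a t \<omega> + \<gamma> * (MAX a'\<in>UNIV. MIN k\<in>{1..N}. Q k (f s a t \<omega>) a' t \<omega>) - Q i s a t \<omega>)"
    and step_range: "\<And>i s a t \<omega>. i \<in> {1..N} \<Longrightarrow> \<omega> \<in> space M \<Longrightarrow>
      0 \<le> \<alpha> i s a t \<omega> \<and> \<alpha> i s a t \<omega> \<le> 1"
    and step_squares: "\<And>i s a. i \<in> {1..N} \<Longrightarrow>
      AE \<omega> in M. summable (\<lambda>t. (\<alpha> i s a t \<omega>)\<^sup>2) \<and> (\<Sum>t. (\<alpha> i s a t \<omega>)\<^sup>2) \<le> C"
    and step_diverges: "\<And>i s a. i \<in> {1..N} \<Longrightarrow>
      AE \<omega> in M. filterlim (\<lambda>n. \<Sum>t<n. \<alpha> i s a t \<omega>) at_top sequentially"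
    and Q_init_Z: "\<And>i z a \<omega>. i \<in> {1..N} \<Longrightarrow> z \<in> Z \<Longrightarrow> \<omega> \<in> space M \<Longrightarrow> Q i z a 0 \<omega> = 0"
begin

section \<open>Measurability and laws of the samples\<close>

lemma space_F [simp]: "space (F t) = space M"
  using filtration.space_F[OF history(1)] .

lemma meas_mono: "s \<le> t \<Longrightarrow> X \<in> measurable (F s) N' \<Longrightarrow> X \<in> measurable (F t) N'"
  using filtration.sets_F_mono[OF history(1), of s t] by (auto simp: measurable_def)

lemma meas_M: "X \<in> measurable (F s) N' \<Longrightarrow> X \<in> measurable M N'"
  using measurable_from_subalg[OF history(2)] .

lemma reward_meas_M [measurable]: "r s a t \<in> borel_measurable M"
  by (rule meas_M[OF reward_meas])

lemma successor_meas_M [measurable]: "f s a t \<in> measurable M (count_space UNIV)"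
  by (rule meas_M[OF successor_meas])

lemma prob_UNIV_law: "measure (R s a) UNIV = 1"
  using reward_law[of s a] prob_space.prob_space[of "R s a"] sets_eq_imp_space_eq[of "R s a" borel]
  by (simp add: reward_law_def)

lemma space_in_F: "space M \<in> sets (F t)"
  using sets.top[of "F t"] by simp

lemma prob_samples:
  assumes "E \<in> sets (F t)" "B \<in> sets borel"
  shows "prob (E \<inter> {\<omega>\<in>space M. r s a t \<omega> \<in> B \<and> f s a t \<omega> \<in> X}) =
    prob E * (measure (R s a) B * measure_pmf.prob (p s a) X)"
  by (rule fresh_samples_marginal[OF samples reward_law assms])

lemma prob_samples':
  assumes "B \<in> sets borel"
  shows "prob {\<omega>\<in>space M. r s a t \<omega> \<in> B \<and> f s a t \<omega> \<in> X} =
    measure (R s a) B * measure_pmf.prob (p s a) X"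
proof -
  have "space M \<inter> {\<omega>\<in>space M. r s a t \<omega> \<in> B \<and> f s a t \<omega> \<in> X} = {\<omega>\<in>space M. r s a t \<omega> \<in> B \<and> f s a t \<omega> \<in> X}"
    by auto
  with prob_samples[OF space_in_F assms, where s = s and a = a and t = t and X = X] show ?thesis by (simp add: prob_space)
qed

lemma distr_reward: "distr M borel (r s a t) = R s a"
proof (rule measure_eqI)
  show sets: "sets (distr M borel (r s a t)) = sets (R s a)"
    using reward_law[of s a] by (simp add: reward_law_def)
  fix A assume "A \<in> sets (distr M borel (r s a t))"
  then have A: "A \<in> sets borel" by simp
  interpret R: prob_space "R s a" using reward_law[of s a] by (simp add: reward_law_def)
  have "prob (r s a t -` A \<inter> space M) = measure (R s a) A"
    using prob_samples'[OF A, where X = UNIV and s = s and a = a and t = t]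
    by (simp add: vimage_def Int_def conj_commute)
  then show "emeasure (distr M borel (r s a t)) A = emeasure (R s a) A"
    using A by (simp add: emeasure_distr emeasure_eq_measure R.emeasure_eq_measure)
qed

lemma reward_noise:
  "predictable_noise M F (\<lambda>t \<omega>. r s a t \<omega> - mean_reward s a)
    (\<integral>x. (x - mean_reward s a)\<^sup>2 \<partial>(R s a))"
proof (intro predictable_noise.intro predictable_noise_axioms.intro)
  note law = reward_law[of s a, unfolded reward_law_def]
  interpret R: prob_space "R s a" using law by simp
  fix t
  have int1: "integrable (distr M borel (r s a t)) (\<lambda>x. x)" using law by (simp add: distr_reward)
  have int2: "integrable (distr M borel (r s a t)) (\<lambda>x. (x - mean_reward s a)\<^sup>2)"
    using law by (simp add: distr_reward power2_diff)
  show "(\<lambda>\<omega>. r s a t \<omega> - mean_reward s a) \<in> borel_measurable (F (Suc t))"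
    using reward_meas[of s a t] by measurable
  show "integrable M (\<lambda>\<omega>. (r s a t \<omega> - mean_reward s a)\<^sup>2)"
    using int2 by (subst (asm) integrable_distr_eq) auto
  have "integrable M (r s a t)" using int1 by (subst (asm) integrable_distr_eq) auto
  moreover have "expectation (r s a t) = mean_reward s a"
    unfolding distr_reward[of s a t, symmetric] by (subst integral_distr) auto
  ultimately show "expectation (\<lambda>\<omega>. r s a t \<omega> - mean_reward s a) = 0" by (simp add: prob_space)
  show "expectation (\<lambda>\<omega>. (r s a t \<omega> - mean_reward s a)\<^sup>2) \<le> (\<integral>x. (x - mean_reward s a)\<^sup>2 \<partial>(R s a))"
    by (subst (2) distr_reward[of s a t, symmetric], subst integral_distr) auto
  fix E :: "'w set" and B :: "real set" assume E: "E \<in> sets (F t)" and B: "B \<in> sets borel"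
  define B' where "B' = (\<lambda>x. x - mean_reward s a) -` B"
  have B': "B' \<in> sets borel"
    unfolding B'_def using measurable_sets_borel[OF _ B, of "\<lambda>x. x - mean_reward s a"] by simp
  have "{\<omega>\<in>space M. r s a t \<omega> - mean_reward s a \<in> B} = {\<omega>\<in>space M. r s a t \<omega> \<in> B' \<and> f s a t \<omega> \<in> UNIV}"
    by (auto simp: B'_def)
  then show "prob (E \<inter> {\<omega>\<in>space M. r s a t \<omega> - mean_reward s a \<in> B}) =
      prob E * prob {\<omega>\<in>space M. r s a t \<omega> - mean_reward s a \<in> B}"
    by (simp only: prob_samples[OF E B'] prob_samples'[OF B'])
qed (fact prob_space_axioms history)+

text \<open>One scalar noise per target state: a random value at the successor, minus its mean,
  becomes a finite sum of predictable coefficients times such noises.\<close>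

lemma successor_noise:
  "predictable_noise M F (\<lambda>t \<omega>. of_bool (f s a t \<omega> = s') - pmf (p s a) s') 1"
proof (intro predictable_noise.intro predictable_noise_axioms.intro)
  fix t
  let ?\<xi> = "\<lambda>\<omega>. of_bool (f s a t \<omega> = s') - pmf (p s a) s' :: real"
  have p01: "- 1 \<le> pmf (p s a) s'" "pmf (p s a) s' \<le> 1"
    using pmf_nonneg[of "p s a" s'] pmf_le_1[of "p s a" s'] by linarith+
  show "?\<xi> \<in> borel_measurable (F (Suc t))"
    using successor_meas[of s a t] by measurable
  then have meas: "?\<xi> \<in> borel_measurable M" by (rule meas_M)
  have bound: "(?\<xi> \<omega>)\<^sup>2 \<le> 1" for \<omega>
    using p01 by (auto simp: abs_square_le_1 abs_le_iff)
  show int2: "integrable M (\<lambda>\<omega>. (?\<xi> \<omega>)\<^sup>2)"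
    using bound meas by (intro integrable_const_bound[where B = 1]) auto
  show "expectation (\<lambda>\<omega>. (?\<xi> \<omega>)\<^sup>2) \<le> 1"
    using integral_mono[OF int2 integrable_const[of 1]] bound by (simp add: prob_space)
  have "prob {\<omega>\<in>space M. f s a t \<omega> = s'} = pmf (p s a) s'"
    using prob_samples'[where B = UNIV and X = "{s'}" and s = s and a = a and t = t] by (simp add: prob_UNIV_law measure_pmf_single)
  moreover have "expectation (\<lambda>\<omega>. of_bool (f s a t \<omega> = s') :: real) = prob {\<omega>\<in>space M. f s a t \<omega> = s'}"
  proof -
    have "expectation (\<lambda>\<omega>. of_bool (f s a t \<omega> = s') :: real) = expectation (indicator {\<omega>\<in>space M. f s a t \<omega> = s'})"
      by (intro Bochner_Integration.integral_cong) (auto simp: indicator_def)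
    then show ?thesis by simp
  qed
  moreover have "integrable M (\<lambda>\<omega>. of_bool (f s a t \<omega> = s') :: real)"
    by (intro integrable_const_bound[where B = 1]) auto
  ultimately show "expectation ?\<xi> = 0" by (simp add: prob_space)
  fix E :: "'w set" and B :: "real set" assume E: "E \<in> sets (F t)" and B: "B \<in> sets borel"
  have UNIV: "UNIV \<in> sets (borel :: real measure)" by simp
  define X where "X = {x. of_bool (x = s') - pmf (p s a) s' \<in> B}"
  have "{\<omega>\<in>space M. ?\<xi> \<omega> \<in> B} = {\<omega>\<in>space M. r s a t \<omega> \<in> UNIV \<and> f s a t \<omega> \<in> X}"
    by (auto simp: X_def)
  then show "prob (E \<inter> {\<omega>\<in>space M. ?\<xi> \<omega> \<in> B}) = prob E * prob {\<omega>\<in>space M. ?\<xi> \<omega> \<in> B}"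
    by (simp only: prob_samples[OF E UNIV] prob_samples'[OF UNIV] prob_UNIV_law)
qed (fact prob_space_axioms history)+

section \<open>Errors, their running maximum and the normalized noise\<close>

definition v :: "'s \<Rightarrow> nat \<Rightarrow> 'w \<Rightarrow> real" where
  "v s t \<omega> = (MAX a'\<in>UNIV. MIN k\<in>{1..N}. Q k s a' t \<omega>)"

abbreviation v_opt :: "'s \<Rightarrow> real" where
  "v_opt s \<equiv> optimal_value p R \<gamma> s"

definition err :: "nat \<times> 's \<times> 'a \<Rightarrow> nat \<Rightarrow> 'w \<Rightarrow> real" where
  "err j t \<omega> = (case j of (i, s, a) \<Rightarrow> Q i s a t \<omega> - optimal_Q p R \<gamma> s a)"

definition J :: "(nat \<times> 's \<times> 'a) set" where
  "J = {1..N} \<times> UNIV \<times> UNIV"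

abbreviation wt :: "nat \<times> 's \<times> 'a \<Rightarrow> real" where
  "wt j \<equiv> w (fst (snd j))"

text \<open>The summand 1 keeps the divisor away from 0 and also dominates the part of
  \<open>v\<close> coming from the optimal value, which the errors do not control.\<close>

definition G :: "nat \<Rightarrow> 'w \<Rightarrow> real" where
  "G t \<omega> = 1 + Max ((\<lambda>(\<tau>, j). \<bar>err j \<tau> \<omega>\<bar> / wt j) ` ({..t} \<times> J))"

lemma finite_J: "finite J" and J_ne: "J \<noteq> {}"
  using estimators by (auto simp: J_def)

lemma v_measurable:
  assumes "\<And>i s a. i \<in> {1..N} \<Longrightarrow> Q i s a t \<in> borel_measurable (F u)"
  shows "v s t \<in> borel_measurable (F u)"
  unfolding v_def using assms by (intro borel_measurable_Max borel_measurable_Min) auto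

lemma Q_measurable: "i \<in> {1..N} \<Longrightarrow> Q i s a t \<in> borel_measurable (F t)"
proof (induction t arbitrary: i s a)
  case (Suc t)
  have old: "Q i s a t \<in> borel_measurable (F (Suc t))" if "i \<in> {1..N}" for i s a
    using meas_mono[OF _ Suc.IH[OF that], of "Suc t"] by simp
  \<comment> \<open>The state at which \<open>v\<close> is evaluated is random, but takes finitely
    many values.\<close>
  have "(\<lambda>\<omega>. v (f s a t \<omega>) t \<omega>) \<in> borel_measurable (F (Suc t))"
    by (rule measurable_compose_countable'[OF v_measurable[OF old] successor_meas])
      (auto intro: countable_finite)
  moreover have "\<alpha> i s a t \<in> borel_measurable (F (Suc t))"
    using meas_mono[OF _ step_meas[OF Suc.prems], of t "Suc t"] by simp
  ultimately have "(\<lambda>\<omega>. Q i s a t \<omega> + \<alpha> i s a t \<omega> * (r s a t \<omega> + \<gamma> * v (f s a t \<omega>) t \<omega> - Q i s a t \<omega>))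
      \<in> borel_measurable (F (Suc t))"
    using old[OF Suc.prems] reward_meas[of s a t] by measurable
  then show ?case
    using iteration[OF Suc.prems] by (subst measurable_cong) (auto simp: v_def)
qed (rule Q_init_meas)

lemma v_meas: "v s t \<in> borel_measurable (F t)"
  by (intro v_measurable Q_measurable)

lemma G_meas: "G t \<in> borel_measurable (F t)"
proof -
  have err: "err j \<tau> \<in> borel_measurable (F t)" if "j \<in> J" "\<tau> \<le> t" for j \<tau>
  proof -
    obtain i s a where j: "j = (i, s, a)" "i \<in> {1..N}" using \<open>j \<in> J\<close> by (auto simp: J_def)
    have "Q i s a \<tau> \<in> borel_measurable (F t)"
      using meas_mono[OF \<open>\<tau> \<le> t\<close> Q_measurable[OF j(2)]] .
    then show ?thesis by (simp add: err_def[abs_def] j)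
  qed
  show ?thesis
    unfolding G_def using err finite_J
    by (intro borel_measurable_add borel_measurable_Max) (auto intro!: borel_measurable_divide)
qed

lemma G_ge:
  assumes "j \<in> J" "\<tau> \<le> t" shows "1 + \<bar>err j \<tau> \<omega>\<bar> / wt j \<le> G t \<omega>"
proof -
  have "\<bar>err j \<tau> \<omega>\<bar> / wt j \<in> (\<lambda>(\<tau>, j). \<bar>err j \<tau> \<omega>\<bar> / wt j) ` ({..t} \<times> J)"
    using assms by force
  then show ?thesis
    unfolding G_def using finite_J by (intro add_left_mono Max_ge) auto
qed

lemma G_attained: "\<exists>\<tau>\<le>t. \<exists>j\<in>J. G t \<omega> = 1 + \<bar>err j \<tau> \<omega>\<bar> / wt j"
proof -
  have "Max ((\<lambda>(\<tau>, j). \<bar>err j \<tau> \<omega>\<bar> / wt j) ` ({..t} \<times> J)) \<in> (\<lambda>(\<tau>, j). \<bar>err j \<tau> \<omega>\<bar> / wt j) ` ({..t} \<times> J)"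
    using finite_J J_ne by (intro Max_in) auto
  then show ?thesis unfolding G_def by auto
qed

lemma G_ge_1: "1 \<le> G t \<omega>"
proof -
  obtain j where "j \<in> J" using J_ne by blast
  moreover have "0 \<le> \<bar>err j t \<omega>\<bar> / wt j" using w_pos[of "fst (snd j)"] by simp
  ultimately show ?thesis using G_ge[of j t t \<omega>] by linarith
qed

lemma mono_G: "mono (\<lambda>t. G t \<omega>)"
proof (rule monoI)
  fix t u :: nat assume "t \<le> u"
  obtain \<tau> j where "\<tau> \<le> t" "j \<in> J" "G t \<omega> = 1 + \<bar>err j \<tau> \<omega>\<bar> / wt j" using G_attained by blast
  then show "G t \<omega> \<le> G u \<omega>" using G_ge[of j \<tau> u \<omega>] \<open>t \<le> u\<close> by simp
qed

lemma err_le_G: "j \<in> J \<Longrightarrow> \<bar>err j t \<omega>\<bar> \<le> G t \<omega> * wt j"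
  using G_ge[of j t t \<omega>] w_pos[of "fst (snd j)"] by (simp add: field_simps)

lemma value_error:
  assumes "\<And>j. j \<in> J \<Longrightarrow> \<bar>err j t \<omega>\<bar> \<le> m * wt j"
  shows "\<bar>v s t \<omega> - v_opt s\<bar> \<le> m * w s"
  unfolding v_def optimal_value_eq_Max[of s]
proof (rule dist_Max_Min_le)
  show "\<bar>Q i s a t \<omega> - optimal_Q p R \<gamma> s a\<bar> \<le> m * w s" if "i \<in> {1..N}" for i a
    using assms[of "(i, s, a)"] that by (simp add: err_def J_def)
qed (use estimators in auto)

lemma v_eq_0:
  assumes "\<And>i a. i \<in> {1..N} \<Longrightarrow> Q i s a t \<omega> = 0"
  shows "v s t \<omega> = 0"
  using dist_Max_Min_le[of "{1..N}" "\<lambda>i a. Q i s a t \<omega>" "\<lambda>_. 0" 0] assms estimators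
  by (simp add: v_def)

text \<open>A deterministic constant such that \<open>v s t\<close> divided by
  \<open>G t * vbound s\<close> is at most 1 in absolute value, as predictable multipliers must
  be.\<close>

definition vbound :: "'s \<Rightarrow> real" where
  "vbound s = \<bar>v_opt s\<bar> + w s"

lemma vbound_pos: "vbound s > 0"
  using w_pos[of s] by (simp add: vbound_def)

lemma v_le_G: "\<bar>v s t \<omega>\<bar> \<le> G t \<omega> * vbound s"
proof -
  have "\<bar>v s t \<omega> - v_opt s\<bar> \<le> G t \<omega> * w s" by (intro value_error err_le_G)
  moreover have "\<bar>v_opt s\<bar> \<le> G t \<omega> * \<bar>v_opt s\<bar>"
    using mult_right_mono[OF G_ge_1, of "\<bar>v_opt s\<bar>" t \<omega>] by simp
  ultimately show ?thesis by (simp add: vbound_def algebra_simps)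
qed

text \<open>The sum is the centred, discounted successor value over \<open>G\<close>, expanded in
  successor indicators to separate past from fresh randomness.\<close>

definition noise :: "'s \<Rightarrow> 'a \<Rightarrow> nat \<Rightarrow> 'w \<Rightarrow> real" where
  "noise s a t \<omega> = (r s a t \<omega> - mean_reward s a) / G t \<omega> +
    (\<Sum>s'\<in>UNIV. \<gamma> * (v s' t \<omega> / G t \<omega>) * (of_bool (f s a t \<omega> = s') - pmf (p s a) s'))"

lemma AE_summable_scaled:
  assumes noise: "predictable_noise M F \<xi> K" and i: "i \<in> {1..N}"
    and c_meas: "\<And>t. c t \<in> borel_measurable (F t)"
    and c_bound: "\<And>t \<omega>. \<omega> \<in> space M \<Longrightarrow> \<bar>c t \<omega>\<bar> \<le> 1"
  shows "AE \<omega> in M. summable (\<lambda>t. \<alpha> i s a t \<omega> * c t \<omega> * \<xi> t \<omega>)"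
proof (rule predictable_noise.AE_summable[OF noise])
  show "(\<lambda>\<omega>. \<alpha> i s a t \<omega> * c t \<omega>) \<in> borel_measurable (F t)" for t
    using c_meas[of t] step_meas[OF i, of s a t] by measurable
  have le: "\<bar>\<alpha> i s a t \<omega> * c t \<omega>\<bar> \<le> \<alpha> i s a t \<omega>" if "\<omega> \<in> space M" for t \<omega>
    using c_bound[OF that, of t] step_range[OF i that, of s a t] by (simp add: abs_mult mult_left_le)
  show "\<bar>\<alpha> i s a t \<omega> * c t \<omega>\<bar> \<le> 1" if "\<omega> \<in> space M" for t \<omega>
    using le[OF that, of t] step_range[OF i that, of s a t] by linarith
  show "AE \<omega> in M. summable (\<lambda>t. (\<alpha> i s a t \<omega> * c t \<omega>)\<^sup>2) \<and> (\<Sum>t. (\<alpha> i s a t \<omega> * c t \<omega>)\<^sup>2) \<le> C"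
    using step_squares[OF i, of s a] AE_space
  proof eventually_elim
    case (elim \<omega>)
    have sq: "(\<alpha> i s a t \<omega> * c t \<omega>)\<^sup>2 \<le> (\<alpha> i s a t \<omega>)\<^sup>2" for t
      using le[OF elim(2), of t] by (simp add: abs_le_square_iff[symmetric])
    have "summable (\<lambda>t. (\<alpha> i s a t \<omega> * c t \<omega>)\<^sup>2)"
      by (rule summable_comparison_test[of _ "\<lambda>t. (\<alpha> i s a t \<omega>)\<^sup>2"]) (use sq elim in auto)
    with suminf_le[OF sq this] elim show ?case by auto
  qed
qed

lemma AE_noise_summable:
  assumes i: "i \<in> {1..N}"
  shows "AE \<omega> in M. summable (\<lambda>t. \<alpha> i s a t \<omega> * noise s a t \<omega>)"
proof -
  have 1: "AE \<omega> in M. summable (\<lambda>t. \<alpha> i s a t \<omega> * (1 / G t \<omega>) * (r s a t \<omega> - mean_reward s a))"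
  proof (rule AE_summable_scaled[OF reward_noise i])
    show "(\<lambda>\<omega>. 1 / G t \<omega>) \<in> borel_measurable (F t)" for t using G_meas[of t] by measurable
    show "\<bar>1 / G t \<omega>\<bar> \<le> 1" for t \<omega> using G_ge_1[of t \<omega>] by (simp add: divide_le_eq_1)
  qed
  have 2: "AE \<omega> in M. summable (\<lambda>t. \<alpha> i s a t \<omega> * (v s' t \<omega> / (G t \<omega> * vbound s')) *
      (of_bool (f s a t \<omega> = s') - pmf (p s a) s'))" for s'
  proof (rule AE_summable_scaled[OF successor_noise i])
    show "(\<lambda>\<omega>. v s' t \<omega> / (G t \<omega> * vbound s')) \<in> borel_measurable (F t)" for t
      using G_meas[of t] v_meas[of s' t] by measurable
    show "\<bar>v s' t \<omega> / (G t \<omega> * vbound s')\<bar> \<le> 1" for t \<omega>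
      using G_ge_1[of t \<omega>] vbound_pos[of s'] v_le_G[of s' t \<omega>] by (simp add: abs_mult divide_le_eq_1)
  qed
  then have "AE \<omega> in M. \<forall>s'\<in>UNIV. summable (\<lambda>t. \<alpha> i s a t \<omega> * (v s' t \<omega> / (G t \<omega> * vbound s')) *
      (of_bool (f s a t \<omega> = s') - pmf (p s a) s'))"
    by (intro AE_finite_allI) auto
  with 1 show ?thesis
  proof eventually_elim
    case (elim \<omega>)
    \<comment> \<open>The constants \<open>\<gamma> * vbound s'\<close> undo the normalization of
      the coefficients.\<close>
    have "summable (\<lambda>t. \<alpha> i s a t \<omega> * (1 / G t \<omega>) * (r s a t \<omega> - mean_reward s a) +
      (\<Sum>s'\<in>UNIV. (\<gamma> * vbound s') * (\<alpha> i s a t \<omega> * (v s' t \<omega> / (G t \<omega> * vbound s')) *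
        (of_bool (f s a t \<omega> = s') - pmf (p s a) s'))))"
      using elim by (intro summable_add summable_sum summable_mult) auto
    moreover have "(\<gamma> * vbound s') * (\<alpha> i s a t \<omega> * (v s' t \<omega> / (G t \<omega> * vbound s')) * x) =
       \<alpha> i s a t \<omega> * (\<gamma> * (v s' t \<omega> / G t \<omega>) * x)" for s' t x
      using vbound_pos[of s'] by (simp add: field_simps)
    ultimately show ?case by (simp add: noise_def sum_distrib_left distrib_left)
  qed
qed

text \<open>Samples drawn at an absorbing reward-free state are almost surely reward 0 and the state
  itself, so the update preserves zero estimates. This is where the initial condition
  enters.\<close>

lemma AE_Q_Z: "AE \<omega> in M. \<forall>i\<in>{1..N}. \<forall>z\<in>Z. \<forall>a t. Q i z a t \<omega> = 0"
proof -
  have "AE \<omega> in M. r z a t \<omega> = 0 \<and> f z a t \<omega> = z" if "z \<in> Z" for z a t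
  proof -
    interpret R: prob_space "R z a" using reward_law[of z a] by (simp add: reward_law_def)
    have "AE x in R z a. x \<in> {0}"
      using absorbing[OF that] by (auto simp: absorbing_reward_free_def)
    moreover have "{0} \<in> sets (R z a)" using reward_law[of z a] by (simp add: reward_law_def)
    ultimately have "measure (R z a) {0} = 1" by (subst R.prob_eq_1) auto
    then have "prob {\<omega>\<in>space M. r z a t \<omega> \<in> {0} \<and> f z a t \<omega> \<in> {z}} = 1"
      by (subst prob_samples') (auto simp: measure_pmf_single pmf_Z[OF that])
    then show ?thesis by (subst (asm) prob_eq_1) auto
  qed
  then have "AE \<omega> in M. \<forall>z\<in>Z. \<forall>a\<in>UNIV. \<forall>t. r z a t \<omega> = 0 \<and> f z a t \<omega> = z"
    by (intro AE_finite_allI) (auto simp: AE_all_countable)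
  with AE_space show ?thesis
  proof eventually_elim
    case (elim \<omega>)
    have "\<forall>i\<in>{1..N}. \<forall>a. Q i z a t \<omega> = 0" if "z \<in> Z" for z t
    proof (induction t)
      case (Suc t)
      have "r z a t \<omega> = 0" "f z a t \<omega> = z" for a using elim(2) that by auto
      moreover have "v z t \<omega> = 0" using Suc by (intro v_eq_0) auto
      ultimately show ?case
        using Suc by (simp only: iteration[OF _ elim(1), folded v_def] simp_thms cong: ball_cong) simp
    qed (use Q_init_Z elim that in auto)
    then show ?case by blast
  qed
qed

text \<open>Subtracting the equation for \<open>optimal_Q\<close> cancels the mean reward; centring
  the reward and the successor value puts all remaining randomness into
  \<open>noise\<close>.\<close>

lemma err_step:
  assumes i: "i \<in> {1..N}" and \<omega>: "\<omega> \<in> space M"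
  shows "err (i, s, a) (Suc t) \<omega> = (1 - \<alpha> i s a t \<omega>) * err (i, s, a) t \<omega> + \<alpha> i s a t \<omega> *
    (\<gamma> * (\<Sum>s'\<in>UNIV. pmf (p s a) s' * (v s' t \<omega> - v_opt s')) + G t \<omega> * noise s a t \<omega>)"
proof -
  have "G t \<omega> * noise s a t \<omega> = r s a t \<omega> - mean_reward s a +
    (\<Sum>s'\<in>UNIV. \<gamma> * v s' t \<omega> * (of_bool (f s a t \<omega> = s') - pmf (p s a) s'))"
  proof -
    have G: "G t \<omega> * (x / G t \<omega>) = x" for x using G_ge_1[of t \<omega>] by simp
    have "G t \<omega> * (\<gamma> * (y / G t \<omega>) * x) = \<gamma> * y * x" for x y using G_ge_1[of t \<omega>] by simp
    then show ?thesis unfolding noise_def distrib_left G sum_distrib_left by simp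
  qed
  also have "(\<Sum>s'\<in>UNIV. \<gamma> * v s' t \<omega> * (of_bool (f s a t \<omega> = s') - pmf (p s a) s')) =
      (\<Sum>s'\<in>UNIV. if f s a t \<omega> = s' then \<gamma> * v s' t \<omega> else 0) - (\<Sum>s'\<in>UNIV. \<gamma> * (pmf (p s a) s' * v s' t \<omega>))"
    unfolding sum_subtractf[symmetric] by (intro sum.cong refl) (simp add: right_diff_distrib)
  also have "\<dots> = \<gamma> * v (f s a t \<omega>) t \<omega> - \<gamma> * (\<Sum>s'\<in>UNIV. pmf (p s a) s' * v s' t \<omega>)"
    by (simp add: sum_distrib_left)
  finally have noise: "G t \<omega> * noise s a t \<omega> = r s a t \<omega> - mean_reward s a +
    (\<gamma> * v (f s a t \<omega>) t \<omega> - \<gamma> * (\<Sum>s'\<in>UNIV. pmf (p s a) s' * v s' t \<omega>))" .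
  have "(\<Sum>s'\<in>UNIV. pmf (p s a) s' * (v s' t \<omega> - v_opt s')) =
      (\<Sum>s'\<in>UNIV. pmf (p s a) s' * v s' t \<omega>) - (\<Sum>s'\<in>UNIV. pmf (p s a) s' * v_opt s')"
    by (simp only: right_diff_distrib sum_subtractf)
  then show ?thesis
    unfolding err_def prod.case optimal_Q_def iteration[OF i \<omega>, of s a t, folded v_def] noise
    by (simp only:) (simp only: algebra_simps)
qed

theorem AE_convergence:
  "AE \<omega> in M. \<forall>i\<in>{1..N}. \<forall>s a. (\<lambda>t. Q i s a t \<omega>) \<longlonglongrightarrow> optimal_Q p R \<gamma> s a"
proof -
  have "AE \<omega> in M. \<forall>j\<in>J. summable (\<lambda>t. (case j of (i, s, a) \<Rightarrow> \<alpha> i s a t \<omega> * noise s a t \<omega>))"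
  proof (intro AE_finite_allI finite_J)
    fix j assume "j \<in> J"
    then obtain i s a where "j = (i, s, a)" "i \<in> {1..N}" by (auto simp: J_def)
    then show "AE \<omega> in M. summable (\<lambda>t. (case j of (i, s, a) \<Rightarrow> \<alpha> i s a t \<omega> * noise s a t \<omega>))"
      using AE_noise_summable[of i s a] by simp
  qed
  moreover have "AE \<omega> in M. \<forall>j\<in>J. filterlim (\<lambda>n. \<Sum>t<n. (case j of (i, s, a) \<Rightarrow> \<alpha> i s a t \<omega>)) at_top sequentially"
  proof (intro AE_finite_allI finite_J)
    fix j assume "j \<in> J"
    then obtain i s a where "j = (i, s, a)" "i \<in> {1..N}" by (auto simp: J_def)
    then show "AE \<omega> in M. filterlim (\<lambda>n. \<Sum>t<n. (case j of (i, s, a) \<Rightarrow> \<alpha> i s a t \<omega>)) at_top sequentially"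
      using step_diverges[of i s a] by simp
  qed
  ultimately show ?thesis
    using AE_space AE_Q_Z
  proof eventually_elim
    case (elim \<omega>)
    have v_Z: "v z t \<omega> = 0" if "z \<in> Z" for z t
      using elim(4) that by (intro v_eq_0) auto
    interpret async_contraction J "\<lambda>j t. err j t \<omega>" "\<lambda>j t. case j of (i, s, a) \<Rightarrow> \<alpha> i s a t \<omega>"
      "\<lambda>j t. case j of (i, s, a) \<Rightarrow> \<gamma> * (\<Sum>s'\<in>UNIV. pmf (p s a) s' * (v s' t \<omega> - v_opt s'))"
      "\<lambda>j t. case j of (i, s, a) \<Rightarrow> noise s a t \<omega>" wt \<beta> "\<lambda>t. G t \<omega>"
    proof
      fix j t m assume "j \<in> J" and le: "\<And>k. k \<in> J \<Longrightarrow> \<bar>err k t \<omega>\<bar> \<le> m * wt k"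
      obtain i s a where j: "j = (i, s, a)" by (cases j)
      have m: "0 \<le> m"
        using order_trans[OF abs_ge_zero le[OF \<open>j \<in> J\<close>]] w_pos[of s] by (simp add: j zero_le_mult_iff)
      \<comment> \<open>Both \<open>v\<close> and the optimal value vanish on \<open>Z\<close>, so
        the full transition sum may be replaced by the contracting kernel.\<close>
      have "\<gamma> * (\<Sum>s'\<in>UNIV. pmf (p s a) s' * (v s' t \<omega> - v_opt s')) =
          (\<Sum>s'\<in>UNIV. transient_kernel p \<gamma> Z s a s' * (v s' t \<omega> - v_opt s'))"
        unfolding sum_distrib_left using v_Z optimal_value_Z
        by (intro sum.cong) (auto simp: transient_kernel_def)
      also have "\<bar>\<dots>\<bar> \<le> (\<Sum>s'\<in>UNIV. transient_kernel p \<gamma> Z s a s' * (m * w s'))"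
        by (rule order_trans[OF sum_abs])
          (auto simp: abs_mult k_nonneg intro!: sum_mono mult_left_mono value_error le)
      also have "\<dots> = m * (\<Sum>s'\<in>UNIV. transient_kernel p \<gamma> Z s a s' * w s')"
        by (simp add: sum_distrib_left algebra_simps)
      also have "\<dots> \<le> m * (\<beta> * w s)" using m weighted by (intro mult_left_mono)
      finally show "\<bar>case j of (i, s, a) \<Rightarrow> \<gamma> * (\<Sum>s'\<in>UNIV. pmf (p s a) s' * (v s' t \<omega> - v_opt s'))\<bar>
          \<le> \<beta> * m * wt j"
        by (simp add: j algebra_simps)
    next
      fix j t assume "j \<in> J"
      then show "err j (Suc t) \<omega> = (1 - (case j of (i, s, a) \<Rightarrow> \<alpha> i s a t \<omega>)) * err j t \<omega> +
        (case j of (i, s, a) \<Rightarrow> \<alpha> i s a t \<omega>) *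
        ((case j of (i, s, a) \<Rightarrow> \<gamma> * (\<Sum>s'\<in>UNIV. pmf (p s a) s' * (v s' t \<omega> - v_opt s'))) +
          G t \<omega> * (case j of (i, s, a) \<Rightarrow> noise s a t \<omega>))"
        using err_step[OF _ elim(3)] by (auto simp: J_def)
    next
      fix j assume "j \<in> J"
      then show "summable (\<lambda>t. (case j of (i, s, a) \<Rightarrow> \<alpha> i s a t \<omega>) * (case j of (i, s, a) \<Rightarrow> noise s a t \<omega>))"
        using elim(1) by (auto simp: case_prod_beta)
    next
      fix t show "\<exists>\<tau>\<le>t. \<exists>j\<in>J. G t \<omega> \<le> 1 + \<bar>err j \<tau> \<omega>\<bar> / wt j"
        using G_attained[of t \<omega>] by (metis order_refl)
      show "0 \<le> G t \<omega>" using G_ge_1[of t \<omega>] by simp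
    qed (use finite_J step_range elim w_pos \<beta> mono_G err_le_G in \<open>auto simp: J_def\<close>)
    show ?case
    proof (intro ballI allI)
      fix i s a assume "i \<in> {1..N}"
      then have "(\<lambda>t. err (i, s, a) t \<omega>) \<longlonglongrightarrow> 0" by (intro y_tendsto_0) (simp add: J_def)
      then show "(\<lambda>t. Q i s a t \<omega>) \<longlonglongrightarrow> optimal_Q p R \<gamma> s a"
        by (simp add: err_def Lim_null[symmetric])
    qed
  qed
qed

end

theorem mainTheorem4:
  fixes M :: "'w measure"
    and F :: "nat \<Rightarrow> 'w measure"
    and p :: "'s::finite \<Rightarrow> 'a::finite \<Rightarrow> 's pmf"
    and R :: "'s \<Rightarrow> 'a \<Rightarrow> real measure"
    and \<gamma> C :: real
    and N :: nat
    and Q :: "nat \<Rightarrow> 's \<Rightarrow> 'a \<Rightarrow> nat \<Rightarrow> 'w \<Rightarrow> real"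
    and \<alpha> :: "nat \<Rightarrow> 's \<Rightarrow> 'a \<Rightarrow> nat \<Rightarrow> 'w \<Rightarrow> real"
    and r :: "'s \<Rightarrow> 'a \<Rightarrow> nat \<Rightarrow> 'w \<Rightarrow> real"
    and f :: "'s \<Rightarrow> 'a \<Rightarrow> nat \<Rightarrow> 'w \<Rightarrow> 's"
  assumes rewards: "\<And>s a. reward_law (R s a)"
    and discount: "0 \<le> \<gamma>" "\<gamma> \<le> 1"
    and estimators: "1 \<le> N"
    and prob: "prob_space M"
    and history: "filtration (space M) F" "\<And>t. subalgebra M (F t)"
    and Q_init_meas: "\<And>i s a. i \<in> {1..N} \<Longrightarrow> Q i s a 0 \<in> borel_measurable (F 0)"
    and step_meas: "\<And>i s a t. i \<in> {1..N} \<Longrightarrow> \<alpha> i s a t \<in> borel_measurable (F t)"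
    and reward_meas: "\<And>s a t. r s a t \<in> borel_measurable (F (Suc t))"
    and successor_meas: "\<And>s a t. f s a t \<in> measurable (F (Suc t)) (count_space UNIV)"
    and samples: "\<And>t. fresh_samples M (F t) p R (\<lambda>s a. r s a t) (\<lambda>s a. f s a t)"
    and iteration: "\<And>i s a t \<omega>. i \<in> {1..N} \<Longrightarrow> \<omega> \<in> space M \<Longrightarrow>
      Q i s a (Suc t) \<omega> = Q i s a t \<omega> + \<alpha> i s a t \<omega> *
        (r s a t \<omega> + \<gamma> * (MAX a'\<in>UNIV. MIN k\<in>{1..N}. Q k (f s a t \<omega>) a' t \<omega>) - Q i s a t \<omega>)"
    and step_range: "\<And>i s a t \<omega>. i \<in> {1..N} \<Longrightarrow> \<omega> \<in> space M \<Longrightarrow>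
      0 \<le> \<alpha> i s a t \<omega> \<and> \<alpha> i s a t \<omega> \<le> 1"
    and step_squares: "\<And>i s a. i \<in> {1..N} \<Longrightarrow>
      AE \<omega> in M. summable (\<lambda>t. (\<alpha> i s a t \<omega>)\<^sup>2) \<and> (\<Sum>t. (\<alpha> i s a t \<omega>)\<^sup>2) \<le> C"
    and step_diverges: "\<And>i s a. i \<in> {1..N} \<Longrightarrow>
      AE \<omega> in M. filterlim (\<lambda>n. \<Sum>t<n. \<alpha> i s a t \<omega>) at_top sequentially"
    and cases: "\<gamma> < 1 \<or>
      (\<gamma> = 1 \<and> (\<exists>s\<^sub>1. absorbing_reward_free p R s\<^sub>1 \<and>
         (\<forall>i\<in>{1..N}. \<forall>a. \<forall>\<omega>\<in>space M. Q i s\<^sub>1 a 0 \<omega> = 0) \<and>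
         (\<forall>\<pi>. proper_policy p s\<^sub>1 \<pi>)))"
  shows "AE \<omega> in M. \<forall>i\<in>{1..N}. \<forall>s a. (\<lambda>t. Q i s a t \<omega>) \<longlonglongrightarrow> optimal_Q p R \<gamma> s a"
proof -
  have "\<exists>Z w \<beta>. transient_mdp p R \<gamma> \<beta> Z w \<and>
    (\<forall>i\<in>{1..N}. \<forall>z\<in>Z. \<forall>a. \<forall>\<omega>\<in>space M. Q i z a 0 \<omega> = 0)"
    using cases
  proof
    assume "\<gamma> < 1"
    \<comment> \<open>Discounting alone contracts the unweighted norm, with factor
      \<open>\<gamma>\<close> and nothing deleted.\<close>
    have "transient_mdp p R \<gamma> \<gamma> {} (\<lambda>_. 1)"
      by unfold_locales
        (use discount \<open>\<gamma> < 1\<close> rewards in \<open>auto simp: transient_kernel_def sum_distrib_left[symmetric] sum_pmf_eq_1\<close>)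
    then show ?thesis by blast
  next
    assume "\<gamma> = 1 \<and> (\<exists>s\<^sub>1. absorbing_reward_free p R s\<^sub>1 \<and>
         (\<forall>i\<in>{1..N}. \<forall>a. \<forall>\<omega>\<in>space M. Q i s\<^sub>1 a 0 \<omega> = 0) \<and>
         (\<forall>\<pi>. proper_policy p s\<^sub>1 \<pi>))"
    then obtain s\<^sub>1 where \<gamma>: "\<gamma> = 1" and s1: "absorbing_reward_free p R s\<^sub>1"
      "\<forall>i\<in>{1..N}. \<forall>a. \<forall>\<omega>\<in>space M. Q i s\<^sub>1 a 0 \<omega> = 0" "\<And>\<pi>. proper_policy p s\<^sub>1 \<pi>"
      by blast
    obtain w \<beta> where w: "0 \<le> \<beta>" "\<beta> < 1" "\<And>s. 0 < w s"
      "\<And>s a. (\<Sum>s'\<in>UNIV. transient_kernel p 1 {s\<^sub>1} s a s' * w s') \<le> \<beta> * w s"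
      using proper_weights[of p s\<^sub>1] s1 unfolding absorbing_reward_free_def by blast
    have "transient_mdp p R \<gamma> \<beta> {s\<^sub>1} w"
      by unfold_locales (use w s1 rewards \<gamma> in \<open>auto simp: transient_kernel_def\<close>)
    then show ?thesis using s1 by blast
  qed
  then obtain Z w \<beta> where mdp: "transient_mdp p R \<gamma> \<beta> Z w"
    and Z: "\<forall>i\<in>{1..N}. \<forall>z\<in>Z. \<forall>a. \<forall>\<omega>\<in>space M. Q i z a 0 \<omega> = 0"
    by blast
  have "maxmin_Q_learning M p R \<gamma> \<beta> Z w F C N Q \<alpha> r f"
    by (intro maxmin_Q_learning.intro maxmin_Q_learning_axioms.intro prob mdp)
      (rule discount estimators history Q_init_meas step_meas reward_meas successor_meas samples
        iteration step_range step_squares step_diverges Z[rule_format]; assumption)+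
  then show ?thesis by (rule maxmin_Q_learning.AE_convergence)
qed

end
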